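(* Let $S$ be a nonempty commutative semigroup and let $G$ be a nilpotent group of class $n$. Let $f:S\to G$ be a polynomial map whose lc-degree is bounded above by a superadditive vector $\bar d\in\mathbb{Z}_*^n$. Then, for every $k\in\mathbb{N}$, the ordered product $\bigodot_{i=1}^kf:\bigoplus_{i=1}^kS\to G$ is a polynomial map whose lc-degree is bounded above by the same superadditive vector $\bar d$. Moreover, if the subgroup $\langle f\rangle$ of $G$ generated by $f(S)$ is finitely generated, then the subgroup generated by the image $\bigodot_{i=1}^kf\left(\bigoplus_{i=1}^kS\right)$ has finite index in $\langle f\rangle$.
   Context: $\mathbb{N}=\{1,2,\ldots\}$, and $\bigoplus_{i=1}^kS$ is the direct sum of $k$ copies of $S$, i.e. $S^k$ with componentwise addition. The ordered product is $\left(\bigodot_{i=1}^kf\right)(s_1,\ldots,s_k)=f(s_1)f(s_2)\cdots f(s_k)$. $\mathbb{Z}_*=\{-\infty\}\cup\{0,1,2,\ldots\}$, with $-\infty<m$, $-\infty+m=-\infty$ for all integers $m$, and $(-\infty)+(-\infty)=-\infty$. A vector $(d_1,\ldots,d_n)\in\mathbb{Z}_*^n$ is superadditive if $d_i\le d_j$ for all $i\le j$ and $d_i+d_j\le d_{i+j}$ for all $i,j\ge1$ with $i+j\le n$. A vector is bounded above by another if the inequality holds in every component. Let $S$ be a nonempty commutative semigroup (written additively) and $G$ a group with identity $1_G$. A map $f:S\to G$ is a polynomial map of degree $-\infty$ if $f(s)=1_G$ for all $s$, and of degree $0$ if it is constant with value different from $1_G$. Thus degree $\le 0$ means constant. Inductively,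 for $d\in\{0,1,2,\dots\}$, $f$ is a polynomial map of degree $\le d+1$ if for every $s\in S$ both maps $L_s(f):t\mapsto f(s+t)f(t)^{-1}$ and $R_s(f):t\mapsto f(t)^{-1}f(s+t)$ from $S$ to $G$ are polynomial maps of degree $\le d$. The degree of a polynomial map is the least such $d\in\{-\infty,0,1,2,\dots\}$. A map is a polynomial map if it is a polynomial map of degree $\le d$ for some $d$. The lower central series is $C^1G=G$, $C^{i+1}G=[C^iG,G]$. If $G$ is nilpotent of class $n$ and $f:S\to G$ is a polynomial map, its lc-degree is the vector $(d_1,\ldots,d_n)\in\mathbb{Z}_*^n$, where $d_i$ is the degree of the induced polynomial map $f\bmod C^{i+1}G:S\to G/C^{i+1}G$. *)

theory Defs
  imports "HOL-Algebra.Generated_Groups"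
begin

text \<open>\<open>MInfty\<close> plays the role of \<open>-\<infinity>\<close>.\<close>

datatype zstar = MInfty | Fin nat

instantiation zstar :: wellorder
begin

fun less_eq_zstar :: "zstar \<Rightarrow> zstar \<Rightarrow> bool" where
  "MInfty \<le> y \<longleftrightarrow> True"
| "Fin m \<le> MInfty \<longleftrightarrow> False"
| "Fin m \<le> Fin n \<longleftrightarrow> m \<le> n"

definition less_zstar :: "zstar \<Rightarrow> zstar \<Rightarrow> bool" where
  "x < y \<longleftrightarrow> x \<le> y \<and> \<not> y \<le> (x :: zstar)"

instance
proof
  fix x y z :: zstar
  show "x < y \<longleftrightarrow> x \<le> y \<and> \<not> y \<le> x" by (simp add: less_zstar_def)
  show "x \<le> x" by (cases x) auto
  show "x \<le> y \<Longrightarrow> y \<le> z \<Longrightarrow> x \<le> z" by (cases x; cases y; cases z) auto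
  show "x \<le> y \<Longrightarrow> y \<le> x \<Longrightarrow> x = y" by (cases x; cases y) auto
  show "x \<le> y \<or> y \<le> x" by (cases x; cases y) auto
next
  fix P :: "zstar \<Rightarrow> bool" and a
  assume step: "\<And>x. (\<And>y. y < x \<Longrightarrow> P y) \<Longrightarrow> P x"
  have bot: "P MInfty"
  proof (rule step)
    fix y assume "y < MInfty"
    then show "P y" by (cases y) (auto simp: less_zstar_def)
  qed
  have "P (Fin n)" for n
  proof (induction n rule: less_induct)
    case (less n)
    show ?case
    proof (rule step)
      fix y assume "y < Fin n"
      then show "P y" using bot less by (cases y) (auto simp: less_zstar_def)
    qed
  qed
  with bot show "P a" by (cases a) auto
qed

end

instantiation zstar :: ab_semigroup_add
begin

fun plus_zstar :: "zstar \<Rightarrow> zstar \<Rightarrow> zstar" where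
  "MInfty + y = MInfty"
| "Fin m + MInfty = MInfty"
| "Fin m + Fin n = Fin (m + n)"

instance
proof
  fix x y z :: zstar
  show "x + y + z = x + (y + z)" by (cases x; cases y; cases z) auto
  show "x + y = y + x" by (cases x; cases y) auto
qed

end

text \<open>Vectors of length \<open>n\<close> are functions on \<open>nat\<close>, of which only the entries with
  indices \<open>1, \<dots>, n\<close> are relevant.\<close>

definition superadditive :: "nat \<Rightarrow> (nat \<Rightarrow> zstar) \<Rightarrow> bool" where
  "superadditive n d \<longleftrightarrow>
     (\<forall>i\<in>{1..n}. \<forall>j\<in>{1..n}. i \<le> j \<longrightarrow> d i \<le> d j) \<and>
     (\<forall>i\<ge>1. \<forall>j\<ge>1. i + j \<le> n \<longrightarrow> d i + d j \<le> d (i + j))"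

definition bounded_above_by :: "nat \<Rightarrow> (nat \<Rightarrow> zstar) \<Rightarrow> (nat \<Rightarrow> zstar) \<Rightarrow> bool" where
  "bounded_above_by n c d \<longleftrightarrow> (\<forall>i\<in>{1..n}. c i \<le> d i)"

record 'a semigrp = "'a partial_object" +
  splus :: "['a, 'a] \<Rightarrow> 'a" (infixl "\<uplus>\<index>" 65)

locale nonempty_comm_semigroup =
  fixes S (structure)
  assumes nonempty: "carrier S \<noteq> {}"
    and splus_closed: "\<lbrakk>x \<in> carrier S; y \<in> carrier S\<rbrakk> \<Longrightarrow> x \<uplus> y \<in> carrier S"
    and splus_assoc: "\<lbrakk>x \<in> carrier S; y \<in> carrier S; z \<in> carrier S\<rbrakk>
      \<Longrightarrow> (x \<uplus> y) \<uplus> z = x \<uplus> (y \<uplus> z)"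
    and splus_comm: "\<lbrakk>x \<in> carrier S; y \<in> carrier S\<rbrakk> \<Longrightarrow> x \<uplus> y = y \<uplus> x"

text \<open>Elements of the \<open>k\<close>-fold direct sum are the lists of length \<open>k\<close> over \<open>S\<close>.\<close>

definition direct_sum :: "nat \<Rightarrow> ('a, 'm) semigrp_scheme \<Rightarrow> 'a list semigrp" where
  "direct_sum k S =
     \<lparr>carrier = {xs. length xs = k \<and> set xs \<subseteq> carrier S}, splus = map2 (splus S)\<rparr>"

lemma nonempty_comm_semigroup_direct_sum:
  assumes "nonempty_comm_semigroup S"
  shows "nonempty_comm_semigroup (direct_sum k S)"
proof -
  interpret nonempty_comm_semigroup S by fact
  have nth: "set xs \<subseteq> carrier S \<longleftrightarrow> (\<forall>i<length xs. xs ! i \<in> carrier S)" for xs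
    by (auto simp: set_conv_nth)
  obtain s where "s \<in> carrier S" using nonempty by blast
  then have "replicate k s \<in> carrier (direct_sum k S)" by (auto simp: direct_sum_def)
  then have "carrier (direct_sum k S) \<noteq> {}" by blast
  then show ?thesis
  proof (rule nonempty_comm_semigroup.intro)
    fix xs ys
    assume "xs \<in> carrier (direct_sum k S)" "ys \<in> carrier (direct_sum k S)"
    then show "xs \<uplus>\<^bsub>direct_sum k S\<^esub> ys = ys \<uplus>\<^bsub>direct_sum k S\<^esub> xs"
      by (intro nth_equalityI) (simp_all add: direct_sum_def nth splus_comm)
  qed (auto simp: direct_sum_def nth splus_closed splus_assoc intro!: nth_equalityI)
qed

definition ordered_product :: "('b, 'n) monoid_scheme \<Rightarrow> ('a \<Rightarrow> 'b) \<Rightarrow> 'a list \<Rightarrow> 'b" where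
  "ordered_product G f xs = foldr (mult G) (map f xs) (one G)"

definition left_diff ::
    "('a, 'm) semigrp_scheme \<Rightarrow> ('b, 'n) monoid_scheme \<Rightarrow> 'a \<Rightarrow> ('a \<Rightarrow> 'b) \<Rightarrow> 'a \<Rightarrow> 'b" where
  "left_diff S G s f = (\<lambda>t. f (s \<uplus>\<^bsub>S\<^esub> t) \<otimes>\<^bsub>G\<^esub> inv\<^bsub>G\<^esub> f t)"

definition right_diff ::
    "('a, 'm) semigrp_scheme \<Rightarrow> ('b, 'n) monoid_scheme \<Rightarrow> 'a \<Rightarrow> ('a \<Rightarrow> 'b) \<Rightarrow> 'a \<Rightarrow> 'b" where
  "right_diff S G s f = (\<lambda>t. inv\<^bsub>G\<^esub> f t \<otimes>\<^bsub>G\<^esub> f (s \<uplus>\<^bsub>S\<^esub> t))"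

primrec degree_le_nat ::
    "('a, 'm) semigrp_scheme \<Rightarrow> ('b, 'n) monoid_scheme \<Rightarrow> nat \<Rightarrow> ('a \<Rightarrow> 'b) \<Rightarrow> bool" where
  "degree_le_nat S G 0 f \<longleftrightarrow> (\<exists>c\<in>carrier G. \<forall>s\<in>carrier S. f s = c)"
| "degree_le_nat S G (Suc d) f \<longleftrightarrow>
     (\<forall>s\<in>carrier S. degree_le_nat S G d (left_diff S G s f) \<and>
                    degree_le_nat S G d (right_diff S G s f))"

definition polynomial_map_le ::
    "('a, 'm) semigrp_scheme \<Rightarrow> ('b, 'n) monoid_scheme \<Rightarrow> zstar \<Rightarrow> ('a \<Rightarrow> 'b) \<Rightarrow> bool" where
  "polynomial_map_le S G d f \<longleftrightarrow> f \<in> carrier S \<rightarrow> carrier G \<and>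
     (case d of MInfty \<Rightarrow> \<forall>s\<in>carrier S. f s = \<one>\<^bsub>G\<^esub> | Fin m \<Rightarrow> degree_le_nat S G m f)"

definition polynomial_map ::
    "('a, 'm) semigrp_scheme \<Rightarrow> ('b, 'n) monoid_scheme \<Rightarrow> ('a \<Rightarrow> 'b) \<Rightarrow> bool" where
  "polynomial_map S G f \<longleftrightarrow> (\<exists>d. polynomial_map_le S G d f)"

text \<open>Only meaningful for polynomial maps.\<close>

definition poly_degree ::
    "('a, 'm) semigrp_scheme \<Rightarrow> ('b, 'n) monoid_scheme \<Rightarrow> ('a \<Rightarrow> 'b) \<Rightarrow> zstar" where
  "poly_degree S G f = (LEAST d. polynomial_map_le S G d f)"

definition commutator_subgroup :: "('b, 'n) monoid_scheme \<Rightarrow> 'b set \<Rightarrow> 'b set \<Rightarrow> 'b set" where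
  "commutator_subgroup G H K =
     generate G (\<Union>h\<in>H. \<Union>k\<in>K. {h \<otimes>\<^bsub>G\<^esub> k \<otimes>\<^bsub>G\<^esub> inv\<^bsub>G\<^esub> h \<otimes>\<^bsub>G\<^esub> inv\<^bsub>G\<^esub> k})"

text \<open>The series is indexed from \<open>1\<close>; the value at \<open>0\<close> is a dummy.\<close>

fun lower_central :: "('b, 'n) monoid_scheme \<Rightarrow> nat \<Rightarrow> 'b set" where
  "lower_central G 0 = carrier G"
| "lower_central G (Suc 0) = carrier G"
| "lower_central G (Suc (Suc i)) =
     commutator_subgroup G (lower_central G (Suc i)) (carrier G)"

definition nilpotent_of_class :: "('b, 'n) monoid_scheme \<Rightarrow> nat \<Rightarrow> bool" where
  "nilpotent_of_class G n \<longleftrightarrow>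
     group G \<and> lower_central G (n + 1) = {\<one>\<^bsub>G\<^esub>} \<and>
     (\<forall>m<n. lower_central G (m + 1) \<noteq> {\<one>\<^bsub>G\<^esub>})"

definition map_mod :: "('b, 'n) monoid_scheme \<Rightarrow> 'b set \<Rightarrow> ('a \<Rightarrow> 'b) \<Rightarrow> 'a \<Rightarrow> 'b set" where
  "map_mod G N f = (\<lambda>s. N #>\<^bsub>G\<^esub> f s)"

definition lc_degree ::
    "('a, 'm) semigrp_scheme \<Rightarrow> ('b, 'n) monoid_scheme \<Rightarrow> ('a \<Rightarrow> 'b) \<Rightarrow> nat \<Rightarrow> zstar" where
  "lc_degree S G f i =
     poly_degree S (G Mod lower_central G (i + 1)) (map_mod G (lower_central G (i + 1)) f)"

definition finitely_generated :: "('b, 'n) monoid_scheme \<Rightarrow> 'b set \<Rightarrow> bool" where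
  "finitely_generated G H \<longleftrightarrow> (\<exists>A. finite A \<and> A \<subseteq> H \<and> generate G A = H)"

definition finite_index_in :: "('b, 'n) monoid_scheme \<Rightarrow> 'b set \<Rightarrow> 'b set \<Rightarrow> bool" where
  "finite_index_in G H K \<longleftrightarrow>
     subgroup H (G\<lparr>carrier := K\<rparr>) \<and> finite (rcosets\<^bsub>G\<lparr>carrier := K\<rparr>\<^esub> H)"

end

theory Submission
  imports Defs "HOL-Algebra.Zassenhaus"
begin

text \<open>
  The degree statement reduces to the fact that polynomial maps into a filtered group form a group.
  Given the superadditive vector \<open>d\<close>, let \<open>F t\<close> be the term \<open>C\<^sup>i\<close> of the lower central series
  for the least \<open>i \<ge> 1\<close> with \<open>t \<le> d\<^sub>i\<close>, and \<open>C\<^sup>n\<^sup>+\<^sup>1\<close> if there is no such \<open>i \<le> n\<close>.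
  Superadditivity of \<open>d\<close> and \<open>[C\<^sup>i, C\<^sup>j] \<subseteq> C\<^sup>i\<^sup>+\<^sup>j\<close> (\<open>commutator_lower_central\<close>) give
  \<open>[F t, F u] \<subseteq> F (t + u)\<close>. On the other hand \<open>f\<close> has degree at most \<open>m\<close> modulo a normal subgroup
  \<open>N\<close> iff all its \<open>(m+1)\<close>-fold differences, left and right ones mixed, take values in \<open>N\<close>; a map
  on a commutative semigroup is constant as soon as its first differences vanish. Hence the
  lc-degree of \<open>f\<close> is bounded by \<open>d\<close> iff for every \<open>t\<close> all \<open>t\<close>-fold differences of \<open>f\<close> lie in \<open>F t\<close>
  (\<open>filtered_poly_iff_diffs_in_lower_central\<close>). Maps with the latter property are closed under
  pointwise products (\<open>filtered_poly_mult\<close>). The coordinate maps \<open>(s\<^sub>1, \<dots>, s\<^sub>k) \<mapsto> f s\<^sub>i\<close> inherit it from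
  \<open>f\<close>, and the ordered product is the pointwise product of these coordinate maps.

  For the index statement, equal arguments show that the image of the ordered product contains all
  powers \<open>f(s)\<^sup>k\<close>. Thus it suffices that in a nilpotent group \<open>G\<close> generated by a finite set \<open>X\<close>, a
  subgroup \<open>K\<close> that contains \<open>x\<^sup>k\<close> for all \<open>x \<in> X\<close> has finite index. The factor
  \<open>C\<^sup>i/C\<^sup>i\<^sup>+\<^sup>1\<close> of the lower central series is central in \<open>G/C\<^sup>i\<^sup>+\<^sup>1\<close> and generated by the finitely many
  \<open>i\<close>-fold commutators of elements of \<open>X\<close>. Commutators are bilinear modulo the next term, so each of
  these generators has a positive power in \<open>K\<close> modulo \<open>C\<^sup>i\<^sup>+\<^sup>1\<close>
  (\<open>lower_central_torsion_generators\<close>). Therefore \<open>K C\<^sup>i\<^sup>+\<^sup>1\<close> has finite index in \<open>K C\<^sup>i\<close>, and these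
  finitely many finite indices combine to that of \<open>K\<close> in \<open>G\<close>.
\<close>

section \<open>Commutators\<close>

definition commutator :: "('b, 'n) monoid_scheme \<Rightarrow> 'b \<Rightarrow> 'b \<Rightarrow> 'b" where
  "commutator G x y = x \<otimes>\<^bsub>G\<^esub> y \<otimes>\<^bsub>G\<^esub> inv\<^bsub>G\<^esub> x \<otimes>\<^bsub>G\<^esub> inv\<^bsub>G\<^esub> y"

context group
begin

lemma inv_mult_cancel: "\<lbrakk>x \<in> carrier G; y \<in> carrier G\<rbrakk> \<Longrightarrow> inv x \<otimes> (x \<otimes> y) = y"
  by (simp flip: m_assoc)

lemma mult_inv_cancel: "\<lbrakk>x \<in> carrier G; y \<in> carrier G\<rbrakk> \<Longrightarrow> x \<otimes> (inv x \<otimes> y) = y"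
  by (simp flip: m_assoc)

text \<open>Together with the simplification rules for inverses and the unit these rewrite products to
  reduced words in the free group; they decide identities between words.\<close>

lemmas group_word = m_assoc inv_mult_group inv_mult_cancel mult_inv_cancel

lemma commutator_closed:
  "\<lbrakk>x \<in> carrier G; y \<in> carrier G\<rbrakk> \<Longrightarrow> commutator G x y \<in> carrier G"
  by (simp add: commutator_def)

lemma commutator_in_subgroup:
  "\<lbrakk>subgroup H G; x \<in> H; y \<in> H\<rbrakk> \<Longrightarrow> commutator G x y \<in> H"
  unfolding commutator_def by (simp add: subgroup.m_closed subgroup.m_inv_closed)

lemma inv_commutator:
  "\<lbrakk>x \<in> carrier G; y \<in> carrier G\<rbrakk> \<Longrightarrow> inv (commutator G x y) = commutator G y x"
  by (simp add: commutator_def group_word)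

lemma commutator_mult_right:
  "\<lbrakk>x \<in> carrier G; a \<in> carrier G; b \<in> carrier G\<rbrakk> \<Longrightarrow>
    commutator G x (a \<otimes> b) = commutator G x a \<otimes> (a \<otimes> commutator G x b \<otimes> inv a)"
  by (simp add: commutator_def group_word)

lemma commutator_inv_right:
  "\<lbrakk>x \<in> carrier G; a \<in> carrier G\<rbrakk> \<Longrightarrow>
    commutator G x (inv a) = inv a \<otimes> inv (commutator G x a) \<otimes> a"
  by (simp add: commutator_def group_word)

lemma conj_closed:
  "\<lbrakk>N \<lhd> G; x \<in> N; g \<in> carrier G\<rbrakk> \<Longrightarrow> g \<otimes> x \<otimes> inv g \<in> N"
  by (simp add: normal.inv_op_closed2)

lemma commutator_in_normal:
  assumes "N \<lhd> G" "x \<in> N" "g \<in> carrier G"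
  shows "commutator G x g \<in> N" "commutator G g x \<in> N"
proof -
  interpret N: normal N G by fact
  have x: "x \<in> carrier G" using assms by auto
  have eq: "commutator G x g = x \<otimes> (g \<otimes> inv x \<otimes> inv g)"
    using x assms(3) by (simp add: commutator_def group_word)
  show "commutator G x g \<in> N"
    unfolding eq using assms by (intro N.m_closed conj_closed) auto
  show "commutator G g x \<in> N"
    unfolding commutator_def using assms by (intro N.m_closed conj_closed) auto
qed

text \<open>The set in question is the preimage of the centralizer of \<open>xN\<close> in \<open>G/N\<close>. It reduces commutator
  conditions modulo \<open>N\<close> to generators.\<close>

lemma centralizer_mod_is_subgroup:
  assumes "N \<lhd> G" "x \<in> carrier G"
  shows "subgroup {y \<in> carrier G. commutator G x y \<in> N} G"
proof -
  interpret N: normal N G by fact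
  show ?thesis
  proof
    fix a b assume "a \<in> {y \<in> carrier G. commutator G x y \<in> N}"
      "b \<in> {y \<in> carrier G. commutator G x y \<in> N}"
    then show "a \<otimes> b \<in> {y \<in> carrier G. commutator G x y \<in> N}"
      using assms by (auto simp: commutator_mult_right conj_closed N.m_closed)
  next
    fix a assume "a \<in> {y \<in> carrier G. commutator G x y \<in> N}"
    then show "inv a \<in> {y \<in> carrier G. commutator G x y \<in> N}"
      using assms N.inv_op_closed1 by (auto simp: commutator_inv_right)
  qed (use assms in \<open>auto simp: commutator_def\<close>)
qed

lemma commutator_mod_generate:
  assumes "N \<lhd> G" "x \<in> carrier G" "Y \<subseteq> carrier G"
    and "\<And>y. y \<in> Y \<Longrightarrow> commutator G x y \<in> N"
    and "z \<in> generate G Y"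
  shows "commutator G x z \<in> N"
  using generate_subgroup_incl[OF _ centralizer_mod_is_subgroup[OF assms(1,2)], of Y] assms(3-5)
  by auto

lemma commutator_mod_swap:
  assumes "N \<lhd> G" "x \<in> carrier G" "y \<in> carrier G" "commutator G x y \<in> N"
  shows "commutator G y x \<in> N"
  using assms inv_commutator[of x y] by (metis normal_imp_subgroup subgroup.m_inv_closed)

lemma commutator_mod_generate_left:
  assumes "N \<lhd> G" "x \<in> carrier G" "Y \<subseteq> carrier G"
    and "\<And>y. y \<in> Y \<Longrightarrow> commutator G y x \<in> N"
    and "z \<in> generate G Y"
  shows "commutator G z x \<in> N"
proof -
  have z: "z \<in> carrier G" using generate_in_carrier[OF assms(3,5)] .
  have "commutator G x y \<in> N" if "y \<in> Y" for y
    using commutator_mod_swap[OF assms(1) _ assms(2) assms(4)[OF that]] that assms(3) by blast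
  then have "commutator G x z \<in> N"
    by (rule commutator_mod_generate[OF assms(1,2,3) _ assms(5)])
  then show ?thesis by (rule commutator_mod_swap[OF assms(1,2) z])
qed

lemma rcoset_hom:
  assumes "N \<lhd> G"
  shows "group_hom G (G Mod N) (\<lambda>x. N #> x)"
  using assms by (simp add: group_hom_def group_hom_axioms_def group_axioms
      normal.factorgroup_is_group normal.r_coset_hom_Mod)

lemma rcoset_eq_one_iff:
  assumes "N \<lhd> G" "x \<in> carrier G"
  shows "N #> x = \<one>\<^bsub>G Mod N\<^esub> \<longleftrightarrow> x \<in> N"
proof -
  have N: "subgroup N G" by (rule normal_imp_subgroup[OF assms(1)])
  have "N #> x = N \<longleftrightarrow> x \<in> N"
    using rcos_self[OF assms(2) N] coset_join2[OF assms(2) N] by auto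
  then show ?thesis by (simp add: FactGroup_def)
qed

lemma commutator_eq_one_iff:
  assumes "x \<in> carrier G" "y \<in> carrier G"
  shows "commutator G x y = \<one> \<longleftrightarrow> x \<otimes> y = y \<otimes> x"
proof
  assume "commutator G x y = \<one>"
  then have "commutator G x y \<otimes> (y \<otimes> x) = y \<otimes> x" using assms by simp
  then show "x \<otimes> y = y \<otimes> x" using assms by (simp add: commutator_def group_word)
next
  assume "x \<otimes> y = y \<otimes> x"
  then have "commutator G x y = y \<otimes> x \<otimes> inv x \<otimes> inv y" using assms by (simp add: commutator_def)
  then show "commutator G x y = \<one>" using assms by (simp add: group_word)
qed

lemma normal_if_commutators:
  assumes "subgroup D G" "\<And>g x. \<lbrakk>g \<in> carrier G; x \<in> D\<rbrakk> \<Longrightarrow> commutator G g x \<in> D"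
  shows "D \<lhd> G"
proof (rule normal_invI[OF assms(1)])
  fix g x assume g: "g \<in> carrier G" "x \<in> D"
  then have x: "x \<in> carrier G" using assms(1) subgroup.subset by blast
  have "commutator G g x \<otimes> x \<in> D" using g assms by (simp add: subgroup.m_closed)
  then show "g \<otimes> x \<otimes> inv g \<in> D" using g x by (simp add: commutator_def group_word)
qed

end

context group_hom
begin

lemma hom_commutator:
  "\<lbrakk>x \<in> carrier G; y \<in> carrier G\<rbrakk> \<Longrightarrow> h (commutator G x y) = commutator H (h x) (h y)"
  by (simp add: commutator_def)

lemma hom_commutator_eq_one_iff:
  assumes "x \<in> carrier G" "y \<in> carrier G"
  shows "h (commutator G x y) = \<one>\<^bsub>H\<^esub> \<longleftrightarrow> h x \<otimes>\<^bsub>H\<^esub> h y = h y \<otimes>\<^bsub>H\<^esub> h x"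
  using assms by (simp add: hom_commutator H.commutator_eq_one_iff)

end

section \<open>The lower central series\<close>

text \<open>The recursion equation in a form that is free of the dummy index \<open>0\<close>.\<close>

lemma lower_central_Suc:
  assumes "1 \<le> i"
  shows "lower_central G (Suc i) =
    generate G {commutator G x y | x y. x \<in> lower_central G i \<and> y \<in> carrier G}"
proof -
  obtain j where "i = Suc j" using assms by (cases i) auto
  then show ?thesis
    by (simp add: commutator_subgroup_def commutator_def)
       (rule arg_cong[where f = "generate G"], auto)
qed

context group
begin

lemma lower_central_normal: "lower_central G i \<lhd> G"
proof (induction i)
  case 0
  then show ?case by (simp add: normal_invI subgroup_self)
next
  case (Suc i)
  show ?case
  proof (cases "i = 0")
    case True
    then show ?thesis by (simp add: normal_invI subgroup_self)
  next
    case False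
    let ?X = "{commutator G x y | x y. x \<in> lower_central G i \<and> y \<in> carrier G}"
    have sub: "lower_central G i \<subseteq> carrier G"
      using Suc normal_imp_subgroup subgroup.subset by blast
    then have X: "?X \<subseteq> carrier G" by (auto simp: subset_iff commutator_closed)
    have "generate G ?X \<lhd> G"
    proof (rule normal_generateI[OF X])
      fix h g assume h: "h \<in> ?X" and g: "g \<in> carrier G"
      then obtain x y where xy: "h = commutator G x y" "x \<in> lower_central G i" "y \<in> carrier G"
        by blast
      have x: "x \<in> carrier G" using sub xy by auto
      have "g \<otimes> h \<otimes> inv g = commutator G (g \<otimes> x \<otimes> inv g) (g \<otimes> y \<otimes> inv g)"
        using x xy g by (simp add: commutator_def group_word)
      then show "g \<otimes> h \<otimes> inv g \<in> ?X"
        using g xy conj_closed[OF Suc] by blast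
    qed
    then show ?thesis using False by (simp add: lower_central_Suc)
  qed
qed

lemma lower_central_subgroup: "subgroup (lower_central G i) G"
  by (rule normal_imp_subgroup[OF lower_central_normal])

lemma lower_central_subset: "lower_central G i \<subseteq> carrier G"
  by (rule subgroup.subset[OF lower_central_subgroup])

lemma commutator_in_lower_central_Suc:
  assumes "1 \<le> i" "x \<in> lower_central G i" "y \<in> carrier G"
  shows "commutator G x y \<in> lower_central G (Suc i)"
  unfolding lower_central_Suc[OF assms(1)] by (rule generate.incl) (use assms in auto)

lemma commutator_in_lower_central_Suc':
  assumes "1 \<le> i" "x \<in> carrier G" "y \<in> lower_central G i"
  shows "commutator G x y \<in> lower_central G (Suc i)"
proof -
  have "y \<in> carrier G" using assms(3) lower_central_subset by blast
  then show ?thesis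
    using commutator_mod_swap[OF lower_central_normal _ assms(2)]
      commutator_in_lower_central_Suc[OF assms(1,3,2)] by blast
qed

lemma lower_central_Suc_subset: "lower_central G (Suc i) \<subseteq> lower_central G i"
proof (cases "i = 0")
  case False
  then show ?thesis
    by (simp add: lower_central_Suc)
      (intro generate_subgroup_incl lower_central_subgroup,
       auto intro: commutator_in_normal lower_central_normal)
qed simp

lemma lower_central_antimono: "i \<le> j \<Longrightarrow> lower_central G j \<subseteq> lower_central G i"
  by (rule lift_Suc_antimono_le[of "lower_central G"]) (rule lower_central_Suc_subset)

text \<open>The computation behind the three subgroups lemma. Put \<open>z = [x,y]\<close> and \<open>v = g y g\<^sup>-\<^sup>1\<close>. Conjugating
  \<open>x y x\<^sup>-\<^sup>1 = z y\<close> by \<open>g\<close> replaces \<open>x\<close> by \<open>[g,x] x\<close> and \<open>y\<close> by \<open>v\<close> and keeps \<open>z\<close>, and the factor \<open>[g,x]\<close>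
  drops out by commutativity; this gives \<open>x v x\<^sup>-\<^sup>1 = z v\<close>. So conjugation by \<open>x\<close> maps
  \<open>[y,g] = y v\<^sup>-\<^sup>1\<close> to \<open>z [y,g] z\<^sup>-\<^sup>1 = [y,g]\<close>.\<close>

lemma commutes_with_commutator:
  assumes "x \<in> carrier G" "y \<in> carrier G" "g \<in> carrier G"
    and z: "commutator G x y \<otimes> g = g \<otimes> commutator G x y"
    and zy: "commutator G x y \<otimes> commutator G y g = commutator G y g \<otimes> commutator G x y"
    and w: "commutator G g x \<otimes> (x \<otimes> (g \<otimes> y \<otimes> inv g) \<otimes> inv x) =
      (x \<otimes> (g \<otimes> y \<otimes> inv g) \<otimes> inv x) \<otimes> commutator G g x"
  shows "x \<otimes> commutator G y g = commutator G y g \<otimes> x"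
proof -
  define z where "z = commutator G x y"
  define v where "v = g \<otimes> y \<otimes> inv g"
  define w where "w = commutator G g x"
  have [simp]: "z \<in> carrier G" "v \<in> carrier G" "w \<in> carrier G"
    using assms by (simp_all add: z_def v_def w_def commutator_closed)
  note [simp] = assms(1-3)
  have "x \<otimes> v \<otimes> inv x = (w \<otimes> (x \<otimes> v \<otimes> inv x)) \<otimes> inv w"
  proof -
    have "w \<otimes> (x \<otimes> v \<otimes> inv x) = (x \<otimes> v \<otimes> inv x) \<otimes> w" using assms by (simp add: v_def w_def)
    then show ?thesis by (simp add: group_word)
  qed
  also have "\<dots> = (g \<otimes> z \<otimes> inv g) \<otimes> v"
    by (simp add: w_def v_def z_def commutator_def group_word)
  also have "g \<otimes> z = z \<otimes> g" using z by (simp add: z_def)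
  then have "(g \<otimes> z \<otimes> inv g) \<otimes> v = z \<otimes> v" by (simp add: group_word)
  finally have v: "x \<otimes> v \<otimes> inv x = z \<otimes> v" .
  have y: "x \<otimes> y \<otimes> inv x = z \<otimes> y" by (simp add: z_def commutator_def group_word)
  have c: "commutator G y g = y \<otimes> inv v" by (simp add: v_def commutator_def group_word)
  have "x \<otimes> commutator G y g \<otimes> inv x = (x \<otimes> y \<otimes> inv x) \<otimes> inv (x \<otimes> v \<otimes> inv x)"
    unfolding c by (simp add: group_word)
  also have "\<dots> = z \<otimes> commutator G y g \<otimes> inv z"
    unfolding v y c by (simp add: group_word)
  also have "\<dots> = commutator G y g"
    using zy by (simp add: z_def[symmetric] c group_word)
  finally have eq: "x \<otimes> commutator G y g \<otimes> inv x = commutator G y g" .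
  have "x \<otimes> commutator G y g = (x \<otimes> commutator G y g \<otimes> inv x) \<otimes> x"
    by (simp add: commutator_closed group_word)
  then show ?thesis by (simp only: eq)
qed

end

lemma (in group_hom) three_commutators_kernel:
  assumes x: "x \<in> carrier G" and y: "y \<in> carrier G" and g: "g \<in> carrier G"
    and z: "h (commutator G (commutator G x y) g) = \<one>\<^bsub>H\<^esub>"
    and zy: "h (commutator G (commutator G x y) (commutator G y g)) = \<one>\<^bsub>H\<^esub>"
    and w: "h (commutator G (commutator G g x) (x \<otimes> (g \<otimes> y \<otimes> inv g) \<otimes> inv x)) = \<one>\<^bsub>H\<^esub>"
  shows "h (commutator G x (commutator G y g)) = \<one>\<^bsub>H\<^esub>"
proof -
  note closed = x y g G.commutator_closed G.m_closed G.inv_closed hom_closed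
  have conj: "x \<otimes> (g \<otimes> y \<otimes> inv g) \<otimes> inv x \<in> carrier G" by (intro closed)
  note comm = hom_commutator_eq_one_iff[THEN iffD1, OF _ _ z, OF G.commutator_closed[OF x y] g]
    hom_commutator_eq_one_iff[THEN iffD1, OF _ _ zy,
      OF G.commutator_closed[OF x y] G.commutator_closed[OF y g]]
    hom_commutator_eq_one_iff[THEN iffD1, OF _ _ w, OF G.commutator_closed[OF g x] conj]
  have "h x \<otimes>\<^bsub>H\<^esub> commutator H (h y) (h g) = commutator H (h y) (h g) \<otimes>\<^bsub>H\<^esub> h x"
  proof (rule H.commutes_with_commutator[of "h x" "h y" "h g", OF hom_closed hom_closed hom_closed])
    show "commutator H (h x) (h y) \<otimes>\<^bsub>H\<^esub> h g = h g \<otimes>\<^bsub>H\<^esub> commutator H (h x) (h y)"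
      using comm(1) by (simp only: closed hom_commutator)
    show "commutator H (h x) (h y) \<otimes>\<^bsub>H\<^esub> commutator H (h y) (h g) =
        commutator H (h y) (h g) \<otimes>\<^bsub>H\<^esub> commutator H (h x) (h y)"
      using comm(2) by (simp only: closed hom_commutator)
    show "commutator H (h g) (h x) \<otimes>\<^bsub>H\<^esub>
          (h x \<otimes>\<^bsub>H\<^esub> (h g \<otimes>\<^bsub>H\<^esub> h y \<otimes>\<^bsub>H\<^esub> inv\<^bsub>H\<^esub> h g) \<otimes>\<^bsub>H\<^esub> inv\<^bsub>H\<^esub> h x) =
        (h x \<otimes>\<^bsub>H\<^esub> (h g \<otimes>\<^bsub>H\<^esub> h y \<otimes>\<^bsub>H\<^esub> inv\<^bsub>H\<^esub> h g) \<otimes>\<^bsub>H\<^esub> inv\<^bsub>H\<^esub> h x) \<otimes>\<^bsub>H\<^esub>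
          commutator H (h g) (h x)"
      using comm(3) by (simp only: closed hom_commutator hom_mult hom_inv)
  qed (use x y g in simp_all)
  then show ?thesis
    by (simp only: hom_commutator closed H.commutator_closed H.commutator_eq_one_iff)
qed

context group
begin

text \<open>Induction on \<open>j\<close> by the three subgroups argument: modulo \<open>C\<^sup>i\<^sup>+\<^sup>j\<^sup>+\<^sup>1\<close> the commutator \<open>[x,y]\<close> with
  \<open>y \<in> C\<^sup>j\<close> is central, and \<open>[g,x] \<in> C\<^sup>i\<^sup>+\<^sup>1\<close> commutes with \<open>C\<^sup>j\<close> by the induction hypothesis at
  \<open>i + 1\<close>. So \<open>x\<close> commutes with the generators \<open>[y,g]\<close> of \<open>C\<^sup>j\<^sup>+\<^sup>1\<close>.\<close>

lemma commutator_lower_central: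
  assumes "1 \<le> i" "1 \<le> j" "x \<in> lower_central G i" "y \<in> lower_central G j"
  shows "commutator G x y \<in> lower_central G (i + j)"
  using assms(2,1,3,4)
proof (induction j arbitrary: i x y rule: dec_induct)
  case base
  then show ?case using commutator_in_lower_central_Suc[of i x y] by simp
next
  case (step j)
  let ?N = "lower_central G (i + Suc j)"
  let ?X = "{commutator G x y | x y. x \<in> lower_central G j \<and> y \<in> carrier G}"
  interpret Q: group_hom G "G Mod ?N" "\<lambda>x. ?N #> x" by (rule rcoset_hom[OF lower_central_normal])
  have kernelI: "?N #> a = \<one>\<^bsub>G Mod ?N\<^esub>" if "a \<in> ?N" for a
    using that lower_central_subset rcoset_eq_one_iff[OF lower_central_normal, of a "i + Suc j"] by blast
  have xc: "x \<in> carrier G" using step.prems lower_central_subset by blast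
  have "y \<in> generate G ?X" using step by (simp add: lower_central_Suc)
  then show ?case
  proof (rule commutator_mod_generate[OF lower_central_normal xc, rotated 2])
    show "?X \<subseteq> carrier G" using lower_central_subset by (auto simp: subset_iff commutator_closed)
    fix c assume "c \<in> ?X"
    then obtain y g where c: "c = commutator G y g" and y: "y \<in> lower_central G j"
      and g: "g \<in> carrier G" by blast
    have yc: "y \<in> carrier G" using y lower_central_subset by blast
    have central: "commutator G (commutator G x y) h \<in> ?N" if "h \<in> carrier G" for h
      using commutator_in_lower_central_Suc[of "i + j" "commutator G x y" h] that step y by simp
    have "commutator G x g \<in> lower_central G (Suc i)"
      using step.prems g by (intro commutator_in_lower_central_Suc)
    then have gx: "commutator G g x \<in> lower_central G (Suc i)"
      using commutator_mod_swap[OF lower_central_normal xc g] by blast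
    have conj: "x \<otimes> (g \<otimes> y \<otimes> inv g) \<otimes> inv x \<in> lower_central G j"
      using y g xc by (intro conj_closed lower_central_normal)
    have w: "commutator G (commutator G g x) (x \<otimes> (g \<otimes> y \<otimes> inv g) \<otimes> inv x) \<in> ?N"
      using step.IH[OF _ gx conj] by simp
    have cc: "c \<in> carrier G" using yc g by (simp add: c commutator_closed)
    have "?N #> commutator G x (commutator G y g) = \<one>\<^bsub>G Mod ?N\<^esub>"
    proof (rule Q.three_commutators_kernel[OF xc yc g])
      show "?N #> commutator G (commutator G x y) g = \<one>\<^bsub>G Mod ?N\<^esub>"
        by (rule kernelI) (rule central[OF g])
      show "?N #> commutator G (commutator G x y) (commutator G y g) = \<one>\<^bsub>G Mod ?N\<^esub>"
        by (rule kernelI) (rule central[OF commutator_closed[OF yc g]])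
      show "?N #> commutator G (commutator G g x) (x \<otimes> (g \<otimes> y \<otimes> inv g) \<otimes> inv x)
          = \<one>\<^bsub>G Mod ?N\<^esub>"
        by (rule kernelI) (rule w)
    qed
    then show "commutator G x c \<in> ?N"
      unfolding c
      by (rule rcoset_eq_one_iff[OF lower_central_normal, THEN iffD1, rotated])
        (intro commutator_closed xc yc g)
  qed
qed

end

section \<open>Iterated differences and degrees\<close>

text \<open>The counterpart, inside the group itself, of a degree bound modulo \<open>N\<close>: it avoids quotients, and
  the values of the map and of all its differences can be compared for different \<open>N\<close>.\<close>

primrec diffs_in ::
    "('a, 'm) semigrp_scheme \<Rightarrow> ('b, 'n) monoid_scheme \<Rightarrow> 'b set \<Rightarrow> nat \<Rightarrow> ('a \<Rightarrow> 'b) \<Rightarrow> bool" where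
  "diffs_in S G N 0 f \<longleftrightarrow> f \<in> carrier S \<rightarrow> N"
| "diffs_in S G N (Suc m) f \<longleftrightarrow>
     (\<forall>s\<in>carrier S. diffs_in S G N m (left_diff S G s f) \<and> diffs_in S G N m (right_diff S G s f))"

lemma diffs_in_mono: "\<lbrakk>diffs_in S G N m f; N \<subseteq> M\<rbrakk> \<Longrightarrow> diffs_in S G M m f"
  by (induction m arbitrary: f) auto

lemma ordered_product_Cons: "ordered_product G f (x # xs) = f x \<otimes>\<^bsub>G\<^esub> ordered_product G f xs"
  by (simp add: ordered_product_def)

context nonempty_comm_semigroup
begin

lemma diffs_in_cong:
  assumes "\<And>x. x \<in> carrier S \<Longrightarrow> f x = g x"
  shows "diffs_in S G N m f \<longleftrightarrow> diffs_in S G N m g"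
  using assms
proof (induction m arbitrary: f g)
  case 0
  then show ?case by (auto simp: Pi_def)
next
  case (Suc m)
  have "diffs_in S G N m (left_diff S G s f) = diffs_in S G N m (left_diff S G s g)"
    "diffs_in S G N m (right_diff S G s f) = diffs_in S G N m (right_diff S G s g)"
    if "s \<in> carrier S" for s
    using that Suc.prems by (intro Suc.IH; simp add: left_diff_def right_diff_def splus_closed)+
  then show ?case by simp
qed

lemma degree_le_nat_cong:
  assumes "\<And>x. x \<in> carrier S \<Longrightarrow> f x = g x"
  shows "degree_le_nat S G m f \<longleftrightarrow> degree_le_nat S G m g"
  using assms
proof (induction m arbitrary: f g)
  case 0
  then show ?case by auto
next
  case (Suc m)
  have "degree_le_nat S G m (left_diff S G s f) = degree_le_nat S G m (left_diff S G s g)"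
    "degree_le_nat S G m (right_diff S G s f) = degree_le_nat S G m (right_diff S G s g)"
    if "s \<in> carrier S" for s
    using that Suc.prems by (intro Suc.IH; simp add: left_diff_def right_diff_def splus_closed)+
  then show ?case by simp
qed

lemma diffs_closed:
  assumes "group G" "subgroup N G" "f \<in> carrier S \<rightarrow> N" "s \<in> carrier S"
  shows "left_diff S G s f \<in> carrier S \<rightarrow> N" "right_diff S G s f \<in> carrier S \<rightarrow> N"
  using assms by (auto simp: left_diff_def right_diff_def Pi_def splus_closed
      intro!: subgroup.m_closed subgroup.m_inv_closed)

text \<open>Differences of a map with values in a subgroup stay in that subgroup.\<close>

lemma diffs_in_Suc:
  assumes "group G" "subgroup N G" "diffs_in S G N m f"
  shows "diffs_in S G N (Suc m) f"
  using assms(3) by (induction m arbitrary: f) (use assms(1,2) in \<open>auto dest: diffs_closed\<close>)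

lemma diffs_in_le:
  assumes "group G" "subgroup N G" "diffs_in S G N m f" "m \<le> k"
  shows "diffs_in S G N k f"
  using assms(4,3) by (induction k rule: dec_induct) (auto intro: diffs_in_Suc[OF assms(1,2)] simp del: diffs_in.simps)

lemma diffs_in_comp:
  assumes T: "nonempty_comm_semigroup T" and p: "p \<in> carrier T \<rightarrow> carrier S"
    and hom: "\<And>x y. \<lbrakk>x \<in> carrier T; y \<in> carrier T\<rbrakk> \<Longrightarrow> p (x \<uplus>\<^bsub>T\<^esub> y) = p x \<uplus> p y"
    and f: "diffs_in S G N m f"
  shows "diffs_in T G N m (\<lambda>x. f (p x))"
  using f
proof (induction m arbitrary: f)
  case 0
  then show ?case using p by auto
next
  case (Suc m)
  interpret T: nonempty_comm_semigroup T by fact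
  show ?case
  proof (simp, intro ballI conjI)
    fix s assume s: "s \<in> carrier T"
    then have "diffs_in T G N m (\<lambda>x. left_diff S G (p s) f (p x))"
      "diffs_in T G N m (\<lambda>x. right_diff S G (p s) f (p x))"
      using Suc p by auto
    then show "diffs_in T G N m (left_diff T G s (\<lambda>x. f (p x)))"
      "diffs_in T G N m (right_diff T G s (\<lambda>x. f (p x)))"
      using s by (auto simp: left_diff_def right_diff_def hom cong: T.diffs_in_cong)
  qed
qed

end

text \<open>A degree bound \<open>z\<close> is the vanishing of all differences of this order, the value \<open>0\<close> for
  \<open>-\<infinity>\<close> being the vanishing of the map itself. This removes the case distinction on \<open>z\<close> from what follows.\<close>

primrec order_of_vanishing :: "zstar \<Rightarrow> nat" where
  "order_of_vanishing MInfty = 0"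
| "order_of_vanishing (Fin m) = Suc m"

lemma order_of_vanishing_le_iff: "order_of_vanishing z \<le> t \<longleftrightarrow> z < Fin t"
  by (cases z) (auto simp: less_zstar_def)

lemma order_of_vanishing_mono: "z \<le> z' \<Longrightarrow> order_of_vanishing z \<le> order_of_vanishing z'"
  by (cases z; cases z') auto

lemma ex_order_of_vanishing: "\<exists>z. order_of_vanishing z = t"
  by (cases t) (auto intro: exI[of _ MInfty] exI[of _ "Fin _"])

locale semigroup_to_group_hom = nonempty_comm_semigroup S + group_hom G H h
  for S (structure) and G (structure) and H (structure) and h
begin

text \<open>Differences commute with homomorphisms, so only the start of the induction needs an argument:
  if \<open>h \<circ> f\<close> is invariant under all translations, then
  \<open>h (f t) = h (f (s + t)) = h (f (t + s)) = h (f s)\<close>, so \<open>h \<circ> f\<close> is constant. This is where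
  commutativity of \<open>S\<close> enters.\<close>

lemma degree_le_nat_iff_diffs_in:
  assumes "f \<in> carrier S \<rightarrow> carrier G"
  shows "degree_le_nat S H m (\<lambda>s. h (f s)) \<longleftrightarrow> diffs_in S G (kernel G H h) (Suc m) f"
  using assms
proof (induction m arbitrary: f)
  case 0
  have f: "f s \<in> carrier G" if "s \<in> carrier S" for s using 0 that by auto
  show ?case
  proof
    assume "degree_le_nat S H 0 (\<lambda>s. h (f s))"
    then obtain c where "c \<in> carrier H" "\<forall>s\<in>carrier S. h (f s) = c" by auto
    then show "diffs_in S G (kernel G H h) (Suc 0) f"
      using f by (auto simp: kernel_def left_diff_def right_diff_def splus_closed)
  next
    assume "diffs_in S G (kernel G H h) (Suc 0) f"
    then have *: "h (f (s \<uplus>\<^bsub>S\<^esub> t) \<otimes>\<^bsub>G\<^esub> inv\<^bsub>G\<^esub> f t) = \<one>\<^bsub>H\<^esub>" if "s \<in> carrier S" "t \<in> carrier S" for s t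
      using that by (auto simp: kernel_def left_diff_def)
    have shift: "h (f (s \<uplus>\<^bsub>S\<^esub> t)) = h (f t)" if "s \<in> carrier S" "t \<in> carrier S" for s t
    proof -
      have "h (f (s \<uplus>\<^bsub>S\<^esub> t)) = h (f (s \<uplus>\<^bsub>S\<^esub> t) \<otimes>\<^bsub>G\<^esub> inv\<^bsub>G\<^esub> f t) \<otimes>\<^bsub>H\<^esub> h (f t)"
        using that f by (simp add: splus_closed H.m_assoc)
      then show ?thesis using that f *[OF that] by simp
    qed
    obtain s where s: "s \<in> carrier S" using nonempty by blast
    have "h (f t) = h (f s)" if "t \<in> carrier S" for t
      using shift[OF s that] shift[OF that s] splus_comm[OF s that] by simp
    then show "degree_le_nat S H 0 (\<lambda>s. h (f s))" using f[OF s] by auto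
  qed
next
  case (Suc m)
  have f: "f s \<in> carrier G" if "s \<in> carrier S" for s using Suc.prems that by auto
  have "degree_le_nat S H m (left_diff S H s (\<lambda>s. h (f s))) \<longleftrightarrow>
      diffs_in S G (kernel G H h) (Suc m) (left_diff S G s f)"
    "degree_le_nat S H m (right_diff S H s (\<lambda>s. h (f s))) \<longleftrightarrow>
      diffs_in S G (kernel G H h) (Suc m) (right_diff S G s f)" if "s \<in> carrier S" for s
    using Suc.IH[of "left_diff S G s f"] Suc.IH[of "right_diff S G s f"]
      diffs_closed[OF G.is_group G.subgroup_self Suc.prems that] that f
    by (auto simp: left_diff_def right_diff_def splus_closed cong: degree_le_nat_cong)
  then show ?case by simp
qed

lemma polynomial_map_le_iff_diffs_in:
  assumes "f \<in> carrier S \<rightarrow> carrier G"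
  shows "polynomial_map_le S H z (\<lambda>s. h (f s)) \<longleftrightarrow>
    diffs_in S G (kernel G H h) (order_of_vanishing z) f"
  using assms degree_le_nat_iff_diffs_in[OF assms]
  by (cases z) (auto simp: polynomial_map_le_def kernel_def Pi_def)

end

lemma polynomial_map_iff_diffs_in:
  assumes "nonempty_comm_semigroup S" "group G" "f \<in> carrier S \<rightarrow> carrier G"
  shows "polynomial_map S G f \<longleftrightarrow> (\<exists>m. diffs_in S G {\<one>\<^bsub>G\<^esub>} m f)"
proof -
  have id: "semigroup_to_group_hom S G G (\<lambda>x. x)"
    using assms(1,2) by (simp add: semigroup_to_group_hom_def group_hom_def group_hom_axioms_def hom_def)
  have ker: "kernel G G (\<lambda>x. x) = {\<one>\<^bsub>G\<^esub>}"
    using group.is_monoid[OF assms(2)] by (auto simp: kernel_def)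
  have "polynomial_map S G f \<longleftrightarrow> (\<exists>z. diffs_in S G {\<one>\<^bsub>G\<^esub>} (order_of_vanishing z) f)"
    using semigroup_to_group_hom.polynomial_map_le_iff_diffs_in[OF id assms(3)]
    by (simp add: polynomial_map_def ker)
  also have "\<dots> \<longleftrightarrow> (\<exists>m. diffs_in S G {\<one>\<^bsub>G\<^esub>} m f)"
  proof
    assume "\<exists>m. diffs_in S G {\<one>\<^bsub>G\<^esub>} m f"
    then obtain m where m: "diffs_in S G {\<one>\<^bsub>G\<^esub>} m f" ..
    obtain z where "order_of_vanishing z = m" using ex_order_of_vanishing ..
    then show "\<exists>z. diffs_in S G {\<one>\<^bsub>G\<^esub>} (order_of_vanishing z) f" using m by blast
  qed blast
  finally show ?thesis .
qed

text \<open>The assumption that \<open>f\<close> is polynomial guarantees that the least degree in the definition of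
  the lc-degree is attained.\<close>

lemma lc_degree_le_iff_diffs_in:
  assumes S: "nonempty_comm_semigroup S" and G: "group G" and f: "f \<in> carrier S \<rightarrow> carrier G"
    and poly: "polynomial_map S G f"
  shows "lc_degree S G f i \<le> z \<longleftrightarrow>
    diffs_in S G (lower_central G (i + 1)) (order_of_vanishing z) f"
proof -
  interpret G: group G by fact
  interpret nonempty_comm_semigroup S by fact
  let ?N = "lower_central G (i + 1)"
  have N: "?N \<lhd> G" "subgroup ?N G"
    by (rule G.lower_central_normal G.lower_central_subgroup)+
  interpret semigroup_to_group_hom S G "G Mod ?N" "\<lambda>x. ?N #>\<^bsub>G\<^esub> x"
    using S G.rcoset_hom[OF N(1)] by (simp add: semigroup_to_group_hom_def)
  have ker: "kernel G (G Mod ?N) (\<lambda>x. ?N #>\<^bsub>G\<^esub> x) = ?N"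
    unfolding kernel_def using G.rcoset_eq_one_iff[OF N(1)] subgroup.subset[OF N(2)] by blast
  have iff: "polynomial_map_le S (G Mod ?N) w (map_mod G ?N f) \<longleftrightarrow>
      diffs_in S G ?N (order_of_vanishing w) f" for w
    using polynomial_map_le_iff_diffs_in[OF f, of w] unfolding ker map_mod_def .
  obtain m where "diffs_in S G {\<one>\<^bsub>G\<^esub>} m f"
    using poly polynomial_map_iff_diffs_in[OF S G f] by blast
  then have "diffs_in S G ?N m f"
    by (rule diffs_in_mono) (use subgroup.one_closed[OF N(2)] in blast)
  then obtain w where "polynomial_map_le S (G Mod ?N) w (map_mod G ?N f)"
    using ex_order_of_vanishing iff by metis
  then have "polynomial_map_le S (G Mod ?N) (lc_degree S G f i) (map_mod G ?N f)"
    unfolding lc_degree_def poly_degree_def by (rule LeastI)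
  then have "diffs_in S G ?N (order_of_vanishing (lc_degree S G f i)) f" by (simp only: iff)
  then show ?thesis
    using diffs_in_le[OF G N(2)] order_of_vanishing_mono iff
    unfolding lc_degree_def poly_degree_def by (metis Least_le)
qed

section \<open>Polynomial maps into a filtered group\<close>

text \<open>The subgroups \<open>F t\<close> are automatically normal in \<open>F 0\<close>, which may be a proper subgroup of the group.\<close>

locale filtration = group G for G (structure) +
  fixes F :: "nat \<Rightarrow> 'a set"
  assumes subgroup_F: "subgroup (F t) G"
    and F_Suc: "F (Suc t) \<subseteq> F t"
    and commutator_F: "\<lbrakk>x \<in> F t; y \<in> F u\<rbrakk> \<Longrightarrow> commutator G x y \<in> F (t + u)"
begin

lemma F_antimono: "t \<le> u \<Longrightarrow> F u \<subseteq> F t"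
  by (rule lift_Suc_antimono_le[of F]) (rule F_Suc)

lemma F_carrier: "x \<in> F t \<Longrightarrow> x \<in> carrier G"
  using subgroup.subset[OF subgroup_F] by blast

end

locale filtered_maps = nonempty_comm_semigroup S + filtration G F
  for S (structure) and G (structure) and F
begin

text \<open>The part of the definition of a polynomial map into the filtration shifted by \<open>t\<close> that concerns
  differences of order at most \<open>r\<close>. The number \<open>r\<close> is the induction parameter in the proof that these
  maps form a group; the shift \<open>t\<close> occurs because a difference of a map for the shift \<open>t\<close> is a map
  for the shift \<open>t + 1\<close>.\<close>

definition poly_upto :: "nat \<Rightarrow> nat \<Rightarrow> ('a \<Rightarrow> 'c) \<Rightarrow> bool" where
  "poly_upto r t f \<longleftrightarrow> (\<forall>u\<le>r. diffs_in S G (F (t + u)) u f)"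

lemma poly_upto_0: "poly_upto 0 t f \<longleftrightarrow> f \<in> carrier S \<rightarrow> F t"
  by (simp add: poly_upto_def)

lemma poly_upto_Suc:
  "poly_upto (Suc r) t f \<longleftrightarrow> f \<in> carrier S \<rightarrow> F t \<and>
    (\<forall>s\<in>carrier S. poly_upto r (Suc t) (left_diff S G s f) \<and> poly_upto r (Suc t) (right_diff S G s f))"
proof -
  have "(\<forall>u\<le>Suc r. P u) \<longleftrightarrow> P 0 \<and> (\<forall>u\<le>r. P (Suc u))" for P
    by (metis Suc_le_mono le0 not0_implies_Suc)
  then show ?thesis by (auto simp: poly_upto_def)
qed

lemma poly_upto_in: "poly_upto r t f \<Longrightarrow> f \<in> carrier S \<rightarrow> F t"
  by (cases r) (auto simp: poly_upto_0 poly_upto_Suc)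

lemma poly_upto_cong: "(\<And>x. x \<in> carrier S \<Longrightarrow> f x = g x) \<Longrightarrow> poly_upto r t f \<longleftrightarrow> poly_upto r t g"
  unfolding poly_upto_def by (auto cong: diffs_in_cong)

lemma poly_upto_pred: "poly_upto (Suc r) t f \<Longrightarrow> poly_upto r t f"
  by (simp add: poly_upto_def)

lemma poly_upto_antimono: "\<lbrakk>poly_upto r u f; t \<le> u\<rbrakk> \<Longrightarrow> poly_upto r t f"
  unfolding poly_upto_def using diffs_in_mono F_antimono by (meson add_right_mono)

lemma left_diff_mult:
  assumes "f \<in> carrier S \<rightarrow> carrier G" "g \<in> carrier S \<rightarrow> carrier G" "s \<in> carrier S" "x \<in> carrier S"
  shows "left_diff S G s (\<lambda>x. f x \<otimes>\<^bsub>G\<^esub> g x) x =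
    left_diff S G s f x \<otimes>\<^bsub>G\<^esub> (commutator G (f x) (left_diff S G s g x) \<otimes>\<^bsub>G\<^esub> left_diff S G s g x)"
proof -
  have "f x \<in> carrier G" "g x \<in> carrier G" "f (s \<uplus> x) \<in> carrier G" "g (s \<uplus> x) \<in> carrier G"
    using assms by (auto simp: splus_closed)
  then show ?thesis by (simp add: left_diff_def commutator_def group_word)
qed

lemma left_diff_inv:
  assumes "f \<in> carrier S \<rightarrow> carrier G" "s \<in> carrier S" "x \<in> carrier S"
  shows "left_diff S G s (\<lambda>x. inv\<^bsub>G\<^esub> f x) x = inv\<^bsub>G\<^esub> (right_diff S G s f x)"
proof -
  have "f x \<in> carrier G" "f (s \<uplus> x) \<in> carrier G"
    using assms by (auto simp: splus_closed)
  then show ?thesis by (simp add: left_diff_def right_diff_def group_word)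
qed

lemma right_diff_eq:
  assumes "f \<in> carrier S \<rightarrow> carrier G" "s \<in> carrier S" "x \<in> carrier S"
  shows "right_diff S G s f x =
    commutator G (inv\<^bsub>G\<^esub> f x) (left_diff S G s f x) \<otimes>\<^bsub>G\<^esub> left_diff S G s f x"
proof -
  have "f x \<in> carrier G" "f (s \<uplus> x) \<in> carrier G"
    using assms by (auto simp: splus_closed)
  then show ?thesis by (simp add: left_diff_def right_diff_def commutator_def group_word)
qed

text \<open>The difference of a commutator as a product of terms each of which is a commutator that
  involves \<open>a\<close> or \<open>b\<close>. With \<open>a\<close> and \<open>b\<close> the differences of two maps with values \<open>x\<close> and \<open>y\<close>, every
  factor thus lies one step deeper in the filtration than \<open>[x,y]\<close>.\<close>

lemma commutator_mult_mult:
  assumes "a \<in> carrier G" "b \<in> carrier G" "x \<in> carrier G" "y \<in> carrier G"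
  shows "commutator G (a \<otimes>\<^bsub>G\<^esub> x) (b \<otimes>\<^bsub>G\<^esub> y) \<otimes>\<^bsub>G\<^esub> inv\<^bsub>G\<^esub> (commutator G x y) =
    commutator G a (commutator G x (b \<otimes>\<^bsub>G\<^esub> y)) \<otimes>\<^bsub>G\<^esub>
    (commutator G x b \<otimes>\<^bsub>G\<^esub>
    (commutator G b (commutator G x y) \<otimes>\<^bsub>G\<^esub>
    (commutator G (commutator G x y) (commutator G a (b \<otimes>\<^bsub>G\<^esub> y)) \<otimes>\<^bsub>G\<^esub> commutator G a (b \<otimes>\<^bsub>G\<^esub> y))))"
  using assms by (simp add: commutator_def group_word)

lemma left_diff_commutator:
  assumes "f \<in> carrier S \<rightarrow> carrier G" "g \<in> carrier S \<rightarrow> carrier G" "s \<in> carrier S" "x \<in> carrier S"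
  defines "a \<equiv> left_diff S G s f x" and "b \<equiv> left_diff S G s g x"
  shows "left_diff S G s (\<lambda>x. commutator G (f x) (g x)) x =
    commutator G a (commutator G (f x) (b \<otimes>\<^bsub>G\<^esub> g x)) \<otimes>\<^bsub>G\<^esub>
    (commutator G (f x) b \<otimes>\<^bsub>G\<^esub>
    (commutator G b (commutator G (f x) (g x)) \<otimes>\<^bsub>G\<^esub>
    (commutator G (commutator G (f x) (g x)) (commutator G a (b \<otimes>\<^bsub>G\<^esub> g x)) \<otimes>\<^bsub>G\<^esub>
     commutator G a (b \<otimes>\<^bsub>G\<^esub> g x))))"
proof -
  have c: "f x \<in> carrier G" "g x \<in> carrier G" "f (s \<uplus> x) \<in> carrier G" "g (s \<uplus> x) \<in> carrier G"
    using assms by (auto simp: splus_closed)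
  then have ab: "a \<in> carrier G" "b \<in> carrier G" "f (s \<uplus> x) = a \<otimes>\<^bsub>G\<^esub> f x" "g (s \<uplus> x) = b \<otimes>\<^bsub>G\<^esub> g x"
    by (simp_all add: a_def b_def left_diff_def group_word)
  show ?thesis
    unfolding left_diff_def ab(3,4) by (rule commutator_mult_mult[OF ab(1,2) c(1,2)])
qed

text \<open>The theorem of Lazard and Leibman. The three closure properties have to be proved together by
  induction on \<open>r\<close>: the left difference of a product contains a commutator, that of an inverse is the
  inverse of a right difference, and that of a commutator is a product of commutators. The
  factors are built from the maps and their differences, which the induction hypothesis handles up to
  order \<open>r\<close>, and each contains a difference, which raises its shift by one.\<close>

lemma poly_upto_mult_inv_commutator:
  "(\<forall>t f g. poly_upto r t f \<longrightarrow> poly_upto r t g \<longrightarrow> poly_upto r t (\<lambda>x. f x \<otimes>\<^bsub>G\<^esub> g x)) \<and>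
   (\<forall>t f. poly_upto r t f \<longrightarrow> poly_upto r t (\<lambda>x. inv\<^bsub>G\<^esub> f x)) \<and>
   (\<forall>t u f g. poly_upto r t f \<longrightarrow> poly_upto r u g \<longrightarrow> poly_upto r (t + u) (\<lambda>x. commutator G (f x) (g x)))"
proof (induction r)
  case 0
  show ?case
    by (auto simp: poly_upto_0 Pi_def commutator_F
        intro: subgroup.m_closed[OF subgroup_F] subgroup.m_inv_closed[OF subgroup_F])
next
  case (Suc r)
  have mult: "poly_upto r t (\<lambda>x. f x \<otimes>\<^bsub>G\<^esub> g x)" if "poly_upto r t f" "poly_upto r t g" for t f g
    using Suc.IH that by blast
  have inv: "poly_upto r t (\<lambda>x. inv\<^bsub>G\<^esub> f x)" if "poly_upto r t f" for t f
    using Suc.IH that by blast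
  have comm: "poly_upto r v (\<lambda>x. commutator G (f x) (g x))"
    if "poly_upto r t f" "poly_upto r u g" "v \<le> t + u" for t u v f g
    using Suc.IH that poly_upto_antimono by blast
  have car: "f \<in> carrier S \<rightarrow> carrier G" if "poly_upto r t f" for r t f
    using poly_upto_in[OF that] F_carrier by blast
  \<comment> \<open>Left differences suffice: a right difference is \<open>h\<^sup>-\<^sup>1 l h = [h\<^sup>-\<^sup>1, l] l\<close> for the left difference \<open>l\<close>.\<close>
  have intro_left: "poly_upto (Suc r) t f"
    if f: "poly_upto r t f" and left: "\<And>s. s \<in> carrier S \<Longrightarrow> poly_upto r (Suc t) (left_diff S G s f)" for t f
  proof -
    have "poly_upto r (Suc t) (right_diff S G s f)" if s: "s \<in> carrier S" for s
    proof -
      have "poly_upto r (Suc t) (\<lambda>x. commutator G (inv\<^bsub>G\<^esub> f x) (left_diff S G s f x) \<otimes>\<^bsub>G\<^esub> left_diff S G s f x)"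
        by (rule mult[OF comm[OF inv[OF f] left[OF s]] left[OF s]]) simp
      then show ?thesis using right_diff_eq[OF car[OF f] s] by (simp cong: poly_upto_cong)
    qed
    then show ?thesis using poly_upto_in[OF f] left by (simp add: poly_upto_Suc)
  qed
  have diff: "poly_upto r (Suc t) (left_diff S G s f)" "poly_upto r (Suc t) (right_diff S G s f)"
    if "poly_upto (Suc r) t f" "s \<in> carrier S" for t f s
    using that by (auto simp: poly_upto_Suc)
  show ?case
  proof (intro conjI allI impI)
    fix t f g assume f: "poly_upto (Suc r) t f" and g: "poly_upto (Suc r) t g"
    show "poly_upto (Suc r) t (\<lambda>x. f x \<otimes>\<^bsub>G\<^esub> g x)"
    proof (rule intro_left[OF mult[OF poly_upto_pred[OF f] poly_upto_pred[OF g]]])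
      fix s assume s: "s \<in> carrier S"
      have "poly_upto r (Suc t) (\<lambda>x. left_diff S G s f x \<otimes>\<^bsub>G\<^esub>
          (commutator G (f x) (left_diff S G s g x) \<otimes>\<^bsub>G\<^esub> left_diff S G s g x))"
        by (rule mult[OF diff(1)[OF f s] mult[OF comm[OF poly_upto_pred[OF f] diff(1)[OF g s]] diff(1)[OF g s]]])
          simp
      then show "poly_upto r (Suc t) (left_diff S G s (\<lambda>x. f x \<otimes>\<^bsub>G\<^esub> g x))"
        using left_diff_mult[OF car[OF f] car[OF g] s] by (simp cong: poly_upto_cong)
    qed
  next
    fix t f assume f: "poly_upto (Suc r) t f"
    show "poly_upto (Suc r) t (\<lambda>x. inv\<^bsub>G\<^esub> f x)"
    proof (rule intro_left[OF inv[OF poly_upto_pred[OF f]]])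
      fix s assume s: "s \<in> carrier S"
      show "poly_upto r (Suc t) (left_diff S G s (\<lambda>x. inv\<^bsub>G\<^esub> f x))"
        using inv[OF diff(2)[OF f s]] left_diff_inv[OF car[OF f] s] by (simp cong: poly_upto_cong)
    qed
  next
    fix t u f g assume f: "poly_upto (Suc r) t f" and g: "poly_upto (Suc r) u g"
    note f' = poly_upto_pred[OF f] and g' = poly_upto_pred[OF g]
    show "poly_upto (Suc r) (t + u) (\<lambda>x. commutator G (f x) (g x))"
    proof (rule intro_left[OF comm[OF f' g' order_refl]])
      fix s assume s: "s \<in> carrier S"
      let ?a = "left_diff S G s f" and ?b = "left_diff S G s g"
      note a = diff(1)[OF f s] and b = diff(1)[OF g s]
      have bg: "poly_upto r u (\<lambda>x. ?b x \<otimes>\<^bsub>G\<^esub> g x)"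
        by (rule mult[OF poly_upto_antimono[OF b] g']) simp
      have c: "poly_upto r (t + u) (\<lambda>x. commutator G (f x) (g x))"
        by (rule comm[OF f' g' order_refl])
      have fbg: "poly_upto r (t + u) (\<lambda>x. commutator G (f x) (?b x \<otimes>\<^bsub>G\<^esub> g x))"
        by (rule comm[OF f' bg order_refl])
      have abg: "poly_upto r (Suc (t + u)) (\<lambda>x. commutator G (?a x) (?b x \<otimes>\<^bsub>G\<^esub> g x))"
        by (rule comm[OF a bg]) simp
      have 1: "poly_upto r (Suc (t + u)) (\<lambda>x. commutator G (?a x) (commutator G (f x) (?b x \<otimes>\<^bsub>G\<^esub> g x)))"
        by (rule comm[OF a fbg]) simp
      have 2: "poly_upto r (Suc (t + u)) (\<lambda>x. commutator G (f x) (?b x))"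
        by (rule comm[OF f' b]) simp
      have 3: "poly_upto r (Suc (t + u)) (\<lambda>x. commutator G (?b x) (commutator G (f x) (g x)))"
        by (rule comm[OF b c]) simp
      have 4: "poly_upto r (Suc (t + u)) (\<lambda>x. commutator G (commutator G (f x) (g x))
          (commutator G (?a x) (?b x \<otimes>\<^bsub>G\<^esub> g x)))"
        by (rule comm[OF c abg]) simp
      have "poly_upto r (Suc (t + u)) (\<lambda>x.
          commutator G (?a x) (commutator G (f x) (?b x \<otimes>\<^bsub>G\<^esub> g x)) \<otimes>\<^bsub>G\<^esub>
          (commutator G (f x) (?b x) \<otimes>\<^bsub>G\<^esub>
          (commutator G (?b x) (commutator G (f x) (g x)) \<otimes>\<^bsub>G\<^esub>
          (commutator G (commutator G (f x) (g x)) (commutator G (?a x) (?b x \<otimes>\<^bsub>G\<^esub> g x)) \<otimes>\<^bsub>G\<^esub>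
           commutator G (?a x) (?b x \<otimes>\<^bsub>G\<^esub> g x)))))"
        by (rule mult[OF 1 mult[OF 2 mult[OF 3 mult[OF 4 abg]]]])
      then show "poly_upto r (Suc (t + u)) (left_diff S G s (\<lambda>x. commutator G (f x) (g x)))"
        using left_diff_commutator[OF car[OF f] car[OF g] s] by (simp cong: poly_upto_cong)
    qed
  qed
qed

definition filtered_poly :: "('a \<Rightarrow> 'c) \<Rightarrow> bool" where
  "filtered_poly f \<longleftrightarrow> (\<forall>t. diffs_in S G (F t) t f)"

lemma filtered_poly_iff_poly_upto: "filtered_poly f \<longleftrightarrow> (\<forall>r. poly_upto r 0 f)"
  by (auto simp: filtered_poly_def poly_upto_def)

lemma filtered_poly_mult:
  "\<lbrakk>filtered_poly f; filtered_poly g\<rbrakk> \<Longrightarrow> filtered_poly (\<lambda>x. f x \<otimes>\<^bsub>G\<^esub> g x)"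
  using poly_upto_mult_inv_commutator unfolding filtered_poly_iff_poly_upto by blast

lemma filtered_poly_one: "filtered_poly (\<lambda>x. \<one>\<^bsub>G\<^esub>)"
  unfolding filtered_poly_def
proof
  fix t
  have "diffs_in S G (F t) 0 (\<lambda>x. \<one>\<^bsub>G\<^esub>)" by (simp add: subgroup.one_closed[OF subgroup_F])
  then show "diffs_in S G (F t) t (\<lambda>x. \<one>\<^bsub>G\<^esub>)"
    by (rule diffs_in_le[OF is_group subgroup_F]) simp
qed

lemma filtered_poly_cong:
  "(\<And>x. x \<in> carrier S \<Longrightarrow> f x = g x) \<Longrightarrow> filtered_poly f \<longleftrightarrow> filtered_poly g"
  unfolding filtered_poly_def by (auto cong: diffs_in_cong)

text \<open>The coordinate projections \<open>S\<^sup>k \<rightarrow> S\<close> are homomorphisms, so \<open>f\<close> composed with any of them is again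
  polynomial; the ordered product multiplies these maps, from the last coordinate to the first.\<close>

lemma filtered_poly_ordered_product:
  assumes f: "filtered_poly f"
  shows "filtered_maps.filtered_poly (direct_sum k S) G F (ordered_product G f)"
proof -
  have D: "nonempty_comm_semigroup (direct_sum k S)"
    by (rule nonempty_comm_semigroup_direct_sum) (rule nonempty_comm_semigroup_axioms)
  interpret D: filtered_maps "direct_sum k S" G F
    by (rule filtered_maps.intro[OF D filtration_axioms])
  have entry: "D.filtered_poly (\<lambda>xs. f (xs ! i))" if i: "i < k" for i
  proof -
    have "diffs_in (direct_sum k S) G (F t) t (\<lambda>xs. f (xs ! i))" for t
      using f i by (intro diffs_in_comp[OF D]) (auto simp: direct_sum_def filtered_poly_def)
    then show ?thesis by (simp add: D.filtered_poly_def)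
  qed
  have "D.filtered_poly (\<lambda>xs. ordered_product G f (drop i xs))" if "i \<le> k" for i
    using that
  proof (induction i rule: inc_induct)
    case base
    have "ordered_product G f (drop k xs) = \<one>\<^bsub>G\<^esub>" if "xs \<in> carrier (direct_sum k S)" for xs
      using that by (simp add: direct_sum_def ordered_product_def)
    then show ?case using D.filtered_poly_one by (simp cong: D.filtered_poly_cong)
  next
    case (step i)
    have "ordered_product G f (drop i xs) = f (xs ! i) \<otimes>\<^bsub>G\<^esub> ordered_product G f (drop (Suc i) xs)"
      if "xs \<in> carrier (direct_sum k S)" for xs
      using that step.hyps by (simp add: direct_sum_def Cons_nth_drop_Suc[symmetric] ordered_product_Cons)
    then show ?case
      using D.filtered_poly_mult[OF entry[OF step.hyps(2)] step.IH] by (simp cong: D.filtered_poly_cong)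
  qed
  from this[of 0] show ?thesis by simp
qed

end

section \<open>The filtration attached to a superadditive vector\<close>

lemma zstar_add_mono: "\<lbrakk>a \<le> c; b \<le> e\<rbrakk> \<Longrightarrow> a + b \<le> c + (e :: zstar)"
  by (cases a; cases b; cases c; cases e) auto

text \<open>An lc-degree of at most \<open>d\<close> forces the \<open>t\<close>-fold differences of a map into \<open>C\<^sup>i\<close> for this index \<open>i\<close>:
  every smaller index \<open>j\<close> has \<open>d\<^sub>j < t\<close>, which puts them into \<open>C\<^sup>j\<^sup>+\<^sup>1\<close>. The disjunct \<open>n < i\<close> yields the value
  \<open>n + 1\<close> when \<open>t\<close> exceeds all degrees.\<close>

definition degree_index :: "nat \<Rightarrow> (nat \<Rightarrow> zstar) \<Rightarrow> nat \<Rightarrow> nat" where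
  "degree_index n d t = (LEAST i. 1 \<le> i \<and> (n < i \<or> Fin t \<le> d i))"

lemma degree_index:
  "1 \<le> degree_index n d t" "degree_index n d t \<le> n + 1"
  "n < degree_index n d t \<or> Fin t \<le> d (degree_index n d t)"
  "\<lbrakk>1 \<le> j; j < degree_index n d t\<rbrakk> \<Longrightarrow> d j < Fin t"
proof -
  let ?P = "\<lambda>i. 1 \<le> i \<and> (n < i \<or> Fin t \<le> d i)"
  have "?P (n + 1)" by simp
  then show "1 \<le> degree_index n d t" "degree_index n d t \<le> n + 1"
    "n < degree_index n d t \<or> Fin t \<le> d (degree_index n d t)"
    unfolding degree_index_def using LeastI[of ?P "n + 1"] Least_le[of ?P "n + 1"] by auto
  show "d j < Fin t" if "1 \<le> j" "j < degree_index n d t"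
    using not_less_Least[of j ?P] that unfolding degree_index_def by auto
qed

lemma degree_index_le: "\<lbrakk>1 \<le> i; Fin t \<le> d i\<rbrakk> \<Longrightarrow> degree_index n d t \<le> i"
  unfolding degree_index_def by (rule Least_le) simp

lemma degree_index_mono: "degree_index n d t \<le> degree_index n d (Suc t)"
proof (cases "n < degree_index n d (Suc t)")
  case True
  then show ?thesis using degree_index(2)[of n d t] by simp
next
  case False
  then have "Fin (Suc t) \<le> d (degree_index n d (Suc t))" using degree_index(3) by blast
  then have "Fin t \<le> d (degree_index n d (Suc t))"
    by (rule order_trans[rotated]) simp
  then show ?thesis using degree_index(1) degree_index_le by blast
qed

lemma degree_index_add:
  assumes "superadditive n d"
  shows "degree_index n d (t + u) \<le> degree_index n d t + degree_index n d u"
proof (cases "n < degree_index n d t + degree_index n d u")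
  case True
  then show ?thesis using degree_index(2)[of n d "t + u"] by simp
next
  case False
  let ?i = "degree_index n d t" and ?j = "degree_index n d u"
  have "Fin t \<le> d ?i" "Fin u \<le> d ?j"
    using False degree_index(3)[of n d t] degree_index(3)[of n d u] by auto
  then have "Fin t + Fin u \<le> d ?i + d ?j" by (rule zstar_add_mono)
  also have "\<dots> \<le> d (?i + ?j)"
    using assms False degree_index(1)[of n d t] degree_index(1)[of n d u]
    unfolding superadditive_def by simp
  finally show ?thesis
    using degree_index(1)[of n d t] by (intro degree_index_le) auto
qed

abbreviation degree_filtration ::
    "('b, 'n) monoid_scheme \<Rightarrow> nat \<Rightarrow> (nat \<Rightarrow> zstar) \<Rightarrow> nat \<Rightarrow> 'b set" where
  "degree_filtration G n d t \<equiv> lower_central G (degree_index n d t)"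

lemma (in group) filtration_degree_filtration:
  assumes "superadditive n d"
  shows "filtration G (degree_filtration G n d)"
proof (rule filtration.intro[OF is_group], rule filtration_axioms.intro)
  show "subgroup (degree_filtration G n d t) G" for t by (rule lower_central_subgroup)
  show "degree_filtration G n d (Suc t) \<subseteq> degree_filtration G n d t" for t
    by (rule lower_central_antimono[OF degree_index_mono])
  show "commutator G x y \<in> degree_filtration G n d (t + u)"
    if "x \<in> degree_filtration G n d t" "y \<in> degree_filtration G n d u" for x y t u
    using commutator_lower_central[OF degree_index(1) degree_index(1) that]
      lower_central_antimono[OF degree_index_add[OF assms]] by blast
qed

lemma degree_index_order_of_vanishing:
  assumes "superadditive n d" "i \<in> {1..n}"
  shows "i < degree_index n d (order_of_vanishing (d i))"
proof (rule ccontr)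
  let ?t = "order_of_vanishing (d i)"
  let ?j = "degree_index n d ?t"
  assume "\<not> i < ?j"
  then have j: "1 \<le> ?j" "?j \<le> i" "Fin ?t \<le> d ?j"
    using degree_index(1,3)[of n d ?t] assms(2) by auto
  then have "d ?j \<le> d i" using assms unfolding superadditive_def by auto
  then have "Fin ?t \<le> d i" using j(3) by simp
  moreover have "d i < Fin ?t" using order_of_vanishing_le_iff by blast
  ultimately show False by simp
qed

text \<open>From left to right take \<open>t = d\<^sub>i + 1\<close>, or \<open>t = 0\<close> if \<open>d\<^sub>i = -\<infinity>\<close>; then \<open>F t \<subseteq> C\<^sup>i\<^sup>+\<^sup>1\<close> by monotonicity of \<open>d\<close>. Conversely,
  if \<open>F t = C\<^sup>j\<^sup>+\<^sup>1\<close> with \<open>j \<ge> 1\<close>, then \<open>d\<^sub>j < t\<close>, and the \<open>(d\<^sub>j + 1)\<close>-fold differences already lie in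
  \<open>C\<^sup>j\<^sup>+\<^sup>1\<close>.\<close>

lemma filtered_poly_iff_diffs_in_lower_central:
  assumes S: "nonempty_comm_semigroup S" and G: "group G" and d: "superadditive n d"
    and f: "f \<in> carrier S \<rightarrow> carrier G"
  shows "filtered_maps.filtered_poly S G (degree_filtration G n d) f \<longleftrightarrow>
    (\<forall>i\<in>{1..n}. diffs_in S G (lower_central G (i + 1)) (order_of_vanishing (d i)) f)"
proof -
  interpret G: group G by fact
  interpret filtered_maps S G "degree_filtration G n d"
    by (rule filtered_maps.intro[OF S G.filtration_degree_filtration[OF d]])
  show ?thesis
  proof
    assume *: "filtered_poly f"
    show "\<forall>i\<in>{1..n}. diffs_in S G (lower_central G (i + 1)) (order_of_vanishing (d i)) f"
    proof
      fix i assume "i \<in> {1..n}"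
      then have "i + 1 \<le> degree_index n d (order_of_vanishing (d i))"
        using degree_index_order_of_vanishing[OF d, of i] by simp
      then show "diffs_in S G (lower_central G (i + 1)) (order_of_vanishing (d i)) f"
        using * unfolding filtered_poly_def by (blast intro: diffs_in_mono G.lower_central_antimono[THEN subsetD])
    qed
  next
    assume *: "\<forall>i\<in>{1..n}. diffs_in S G (lower_central G (i + 1)) (order_of_vanishing (d i)) f"
    show "filtered_poly f"
      unfolding filtered_poly_def
    proof
      fix t
      let ?i = "degree_index n d t"
      show "diffs_in S G (lower_central G ?i) t f"
      proof (cases "?i = 1")
        case True
        have "diffs_in S G (carrier G) 0 f" using f by simp
        then show ?thesis
          using True diffs_in_le[OF G G.subgroup_self, of 0 f t] by simp
      next
        case False
        define j where "j = ?i - 1"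
        have j: "j \<in> {1..n}" "j + 1 = ?i" "d j < Fin t"
          using degree_index(1,2)[of n d t] degree_index(4)[of j n d t] False by (auto simp: j_def)
        then have "order_of_vanishing (d j) \<le> t" by (simp add: order_of_vanishing_le_iff)
        then show ?thesis
          using * j diffs_in_le[OF G G.lower_central_subgroup] by metis
      qed
    qed
  qed
qed

lemma ordered_product_lc_degree:
  fixes S :: "('a, 'm) semigrp_scheme" and G :: "('b, 'n) monoid_scheme"
  assumes S: "nonempty_comm_semigroup S" and nil: "nilpotent_of_class G n"
    and poly: "polynomial_map S G f" and d: "superadditive n d"
    and bound: "bounded_above_by n (lc_degree S G f) d"
  shows "polynomial_map (direct_sum k S) G (ordered_product G f) \<and>
    bounded_above_by n (lc_degree (direct_sum k S) G (ordered_product G f)) d"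
proof -
  have G: "group G" and triv: "lower_central G (n + 1) = {\<one>\<^bsub>G\<^esub>}"
    using nil by (auto simp: nilpotent_of_class_def)
  interpret G: group G by fact
  interpret filtered_maps S G "degree_filtration G n d"
    by (rule filtered_maps.intro[OF S G.filtration_degree_filtration[OF d]])
  have f: "f \<in> carrier S \<rightarrow> carrier G"
    using poly by (auto simp: polynomial_map_def polynomial_map_le_def)
  let ?T = "direct_sum k S" and ?g = "ordered_product G f"
  have T: "nonempty_comm_semigroup ?T" by (rule nonempty_comm_semigroup_direct_sum[OF S])
  interpret T: filtered_maps ?T G "degree_filtration G n d"
    by (rule filtered_maps.intro[OF T G.filtration_degree_filtration[OF d]])
  have "filtered_poly f"
    using bound
    by (simp add: filtered_poly_iff_diffs_in_lower_central[OF S G d f] bounded_above_by_def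
        lc_degree_le_iff_diffs_in[OF S G f poly])
  then have *: "T.filtered_poly ?g" by (rule filtered_poly_ordered_product)
  have "ordered_product G f xs \<in> carrier G" if "set xs \<subseteq> carrier S" for xs
    using that f by (induction xs) (auto simp: ordered_product_def)
  then have g: "?g \<in> carrier ?T \<rightarrow> carrier G" by (auto simp: direct_sum_def)
  \<comment> \<open>The bound on the last component makes all differences of order \<open>t\<close> trivial, since then
    \<open>F t = C\<^sup>n\<^sup>+\<^sup>1 = 1\<close>; for \<open>n = 0\<close> the group itself is trivial.\<close>
  define t where "t = (if n = 0 then 0 else order_of_vanishing (d n))"
  have "n < degree_index n d t"
    using degree_index_order_of_vanishing[OF d, of n] degree_index(1)[of n d t] by (auto simp: t_def)
  then have "degree_index n d t = n + 1" using degree_index(2)[of n d t] by simp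
  then have "diffs_in ?T G {\<one>\<^bsub>G\<^esub>} t ?g"
    using * triv by (metis T.filtered_poly_def)
  then have poly_g: "polynomial_map ?T G ?g"
    using polynomial_map_iff_diffs_in[OF T G g] by blast
  moreover have "bounded_above_by n (lc_degree ?T G ?g) d"
    using * by (simp add: filtered_poly_iff_diffs_in_lower_central[OF T G d g] bounded_above_by_def
        lc_degree_le_iff_diffs_in[OF T G g poly_g])
  ultimately show ?thesis by blast
qed

section \<open>Finite index of subgroups of nilpotent groups\<close>

context group
begin

text \<open>If \<open>z = [y,x]\<close> commutes with \<open>x\<close>, moving \<open>y\<close> past \<open>x\<^sup>k\<close> produces one factor \<open>z\<close> for each \<open>x\<close>.\<close>

lemma mult_pow_commutator:
  assumes x: "x \<in> carrier G" and y: "y \<in> carrier G" and z: "z \<in> carrier G"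
    and yx: "y \<otimes> x = z \<otimes> (x \<otimes> y)"
    and zx: "z \<otimes> x = x \<otimes> z"
  shows "y \<otimes> x [^] (k::nat) = z [^] k \<otimes> (x [^] k \<otimes> y)"
proof (induction k)
  case (Suc k)
  have zk: "x [^] k \<otimes> z = z \<otimes> x [^] k"
    using group_commutes_pow[of x z k] zx x z by simp
  have "y \<otimes> x [^] Suc k = (y \<otimes> x [^] k) \<otimes> x" using x y by (simp add: m_assoc)
  also have "\<dots> = z [^] k \<otimes> (x [^] k \<otimes> (y \<otimes> x))" using x y z by (simp add: Suc.IH m_assoc)
  also have "\<dots> = z [^] k \<otimes> ((x [^] k \<otimes> z) \<otimes> (x \<otimes> y))" using x y z by (simp add: yx m_assoc)
  also have "\<dots> = z [^] Suc k \<otimes> (x [^] Suc k \<otimes> y)" using x y z by (simp add: zk m_assoc)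
  finally show ?case .
qed (use x y in simp)

lemma pow_mult_commutator:
  assumes x: "x \<in> carrier G" and y: "y \<in> carrier G" and z: "z \<in> carrier G"
    and yx: "y \<otimes> x = z \<otimes> (x \<otimes> y)"
    and zy: "z \<otimes> y = y \<otimes> z"
  shows "y [^] (m::nat) \<otimes> x = z [^] m \<otimes> (x \<otimes> y [^] m)"
proof (induction m)
  case (Suc m)
  have zm: "y [^] m \<otimes> z = z \<otimes> y [^] m"
    using group_commutes_pow[of y z m] zy y z by simp
  have "y [^] Suc m \<otimes> x = y [^] m \<otimes> (y \<otimes> x)" using x y by (simp add: m_assoc)
  also have "\<dots> = (y [^] m \<otimes> z) \<otimes> (x \<otimes> y)" using x y z by (simp add: yx m_assoc)
  also have "\<dots> = z \<otimes> ((y [^] m \<otimes> x) \<otimes> y)" using x y z by (simp add: zm m_assoc)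
  also have "\<dots> = (z \<otimes> z [^] m) \<otimes> (x \<otimes> y [^] Suc m)" using x y z by (simp add: Suc.IH m_assoc)
  also have "z \<otimes> z [^] m = z [^] Suc m" using z by (metis nat_pow_Suc2)
  finally show ?case .
qed (use x y in simp)

text \<open>Since \<open>[y,x]\<close> commutes with \<open>x\<close> and \<open>y\<close>, we have \<open>[y\<^sup>m, x\<^sup>k] = [y,x]\<^sup>m\<^sup>k\<close>.\<close>

lemma commutator_pow_eq_one:
  assumes x: "x \<in> carrier G" and y: "y \<in> carrier G"
    and zx: "commutator G y x \<otimes> x = x \<otimes> commutator G y x"
    and zy: "commutator G y x \<otimes> y = y \<otimes> commutator G y x"
    and comm: "y [^] (m::nat) \<otimes> x [^] (k::nat) = x [^] k \<otimes> y [^] m"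
  shows "commutator G y x [^] (m * k) = \<one>"
proof -
  define z where "z = commutator G y x"
  have z: "z \<in> carrier G" using x y by (simp add: z_def commutator_closed)
  have "y \<otimes> x = z \<otimes> (x \<otimes> y)" using x y by (simp add: z_def commutator_def group_word)
  then have "y [^] m \<otimes> x = z [^] m \<otimes> (x \<otimes> y [^] m)"
    using pow_mult_commutator[OF x y z] zy by (simp add: z_def)
  moreover have "z [^] m \<otimes> x = x \<otimes> z [^] m"
    using group_commutes_pow[of z x m] zx x z by (simp add: z_def)
  ultimately have "y [^] m \<otimes> x [^] k = (z [^] m) [^] k \<otimes> (x [^] k \<otimes> y [^] m)"
    using mult_pow_commutator[of x "y [^] m" "z [^] m" k] x y z by simp
  also have "(z [^] m) [^] k = z [^] (m * k)" using z by (rule nat_pow_pow)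
  finally have "z [^] (m * k) \<otimes> (x [^] k \<otimes> y [^] m) = x [^] k \<otimes> y [^] m" using comm by simp
  then show ?thesis
    using x y z by (simp add: z_def[symmetric])
qed

text \<open>In \<open>G/D\<close> the element \<open>yD\<close> has order dividing \<open>m\<close>, so every element of the cyclic group that it
  generates is a power with exponent below \<open>m\<close>.\<close>

lemma generate_insert_normal_cover:
  assumes D: "D \<lhd> G" and y: "y \<in> carrier G" and m: "0 < m" "y [^] (m::nat) \<in> D"
  shows "generate G (insert y D) \<subseteq> D <#> (\<lambda>e. y [^] e) ` {..<m}"
proof
  interpret Q: group_hom G "G Mod D" "\<lambda>x. D #> x" by (rule rcoset_hom[OF D])
  let ?q = "D #> y"
  let ?P = "{x \<in> carrier G. \<exists>e::int. D #> x = ?q [^]\<^bsub>G Mod D\<^esub> e}"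
  note Dsub = normal_imp_subgroup[OF D]
  have q: "?q \<in> carrier (G Mod D)" by (rule Q.hom_closed[OF y])
  have "D #> y [^] m = \<one>\<^bsub>G Mod D\<^esub>"
    using m(2) y by (subst rcoset_eq_one_iff[OF D]) auto
  then have qm: "?q [^]\<^bsub>G Mod D\<^esub> int m = \<one>\<^bsub>G Mod D\<^esub>"
    using Q.hom_nat_pow[OF y, of m] by (simp only: int_pow_int)
  have P: "subgroup ?P G"
  proof
    show "?P \<subseteq> carrier G" by blast
    show "\<one> \<in> ?P"
      using Q.hom_one int_pow_0[of "G Mod D" ?q] one_closed by (metis (mono_tags, lifting) mem_Collect_eq)
  next
    fix a b assume "a \<in> ?P" "b \<in> ?P"
    then obtain e e' :: int where "a \<in> carrier G" "b \<in> carrier G"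
      "D #> a = ?q [^]\<^bsub>G Mod D\<^esub> e" "D #> b = ?q [^]\<^bsub>G Mod D\<^esub> e'" by blast
    then have "D #> (a \<otimes> b) = ?q [^]\<^bsub>G Mod D\<^esub> (e + e')"
      using q Q.hom_mult by (simp only: Q.H.int_pow_mult)
    then show "a \<otimes> b \<in> ?P" using \<open>a \<in> carrier G\<close> \<open>b \<in> carrier G\<close> by blast
  next
    fix a assume "a \<in> ?P"
    then obtain e :: int where "a \<in> carrier G" "D #> a = ?q [^]\<^bsub>G Mod D\<^esub> e" by blast
    then have "D #> inv a = ?q [^]\<^bsub>G Mod D\<^esub> (- e)"
      using q by (simp only: Q.H.int_pow_neg Q.hom_inv)
    then show "inv a \<in> ?P" using \<open>a \<in> carrier G\<close> by blast
  qed
  have "D #> y = ?q [^]\<^bsub>G Mod D\<^esub> (1::int)" using q by (simp only: Q.H.int_pow_1)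
  moreover have "D #> d = ?q [^]\<^bsub>G Mod D\<^esub> (0::int)" if "d \<in> D" for d
    using that rcoset_eq_one_iff[OF D, of d] subgroup.subset[OF Dsub] by (auto simp only: int_pow_0)
  ultimately have "insert y D \<subseteq> ?P" using y subgroup.subset[OF Dsub] by blast
  then have gen: "generate G (insert y D) \<subseteq> ?P" by (rule generate_subgroup_incl[OF _ P])
  fix x assume "x \<in> generate G (insert y D)"
  then obtain e :: int where x: "x \<in> carrier G" "D #> x = ?q [^]\<^bsub>G Mod D\<^esub> e" using gen by blast
  define r where "r = nat (e mod int m)"
  have r: "r < m" "e = int m * (e div int m) + int r" using m(1) by (auto simp: r_def nat_less_iff)
  have "?q [^]\<^bsub>G Mod D\<^esub> e =
      (?q [^]\<^bsub>G Mod D\<^esub> int m) [^]\<^bsub>G Mod D\<^esub> (e div int m) \<otimes>\<^bsub>G Mod D\<^esub> ?q [^]\<^bsub>G Mod D\<^esub> int r"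
    by (subst r(2)) (simp only: Q.H.int_pow_mult[OF q] Q.H.int_pow_pow[OF q])
  also have "\<dots> = ?q [^]\<^bsub>G Mod D\<^esub> r"
    unfolding qm Q.H.int_pow_one
    by (simp only: int_pow_int Q.H.l_one[OF Q.H.nat_pow_closed[OF q]])
  also have "\<dots> = D #> y [^] r" using Q.hom_nat_pow[OF y] by simp
  finally have "D #> x = D #> y [^] r" using x by simp
  then have "x \<in> D #> y [^] r" using rcos_self[OF x(1) Dsub] by simp
  then show "x \<in> D <#> (\<lambda>e. y [^] e) ` {..<m}"
    using r(1) by (auto simp: r_coset_def set_mult_def)
qed

lemma finite_set_mult: "\<lbrakk>finite A; finite B\<rbrakk> \<Longrightarrow> finite (A <#> B)"
  by (simp add: set_mult_def)

lemma normal_generate_mod_central: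
  assumes B: "B \<lhd> G" and Y: "Y \<subseteq> carrier G"
    and central: "\<And>g y. \<lbrakk>g \<in> carrier G; y \<in> Y\<rbrakk> \<Longrightarrow> commutator G g y \<in> B"
  shows "generate G (Y \<union> B) \<lhd> G"
proof (rule normal_if_commutators)
  have YB: "Y \<union> B \<subseteq> carrier G" using Y normal_imp_subgroup[OF B] subgroup.subset by blast
  then show "subgroup (generate G (Y \<union> B)) G" by (rule generate_is_subgroup)
  fix g x assume g: "g \<in> carrier G" "x \<in> generate G (Y \<union> B)"
  have "commutator G g x \<in> B"
    using central commutator_in_normal(2)[OF B] g
    by (intro commutator_mod_generate[OF B g(1) YB _ g(2)]) auto
  then show "commutator G g x \<in> generate G (Y \<union> B)" by (simp add: generate.incl)
qed

text \<open>In \<open>G/B\<close> the elements of \<open>Y\<close> are central of finite order and finite in number, so they generate a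
  finite group. The generators are added one at a time; centrality keeps the subgroups normal.\<close>

lemma central_torsion_cover:
  assumes B: "B \<lhd> G" and "finite Y" "Y \<subseteq> carrier G"
    and "\<And>g y. \<lbrakk>g \<in> carrier G; y \<in> Y\<rbrakk> \<Longrightarrow> commutator G g y \<in> B"
    and "\<And>y. y \<in> Y \<Longrightarrow> \<exists>m>0. y [^] (m::nat) \<in> B"
  shows "\<exists>T. finite T \<and> T \<subseteq> carrier G \<and> generate G (Y \<union> B) \<subseteq> B <#> T"
  using assms(2-)
proof (induction Y rule: finite_induct)
  case empty
  have Bsub: "subgroup B G" using B by (rule normal_imp_subgroup)
  have "B \<subseteq> B <#> {\<one>}"
    using subgroup.subset[OF Bsub] by (force simp: set_mult_def)
  then have "generate G ({} \<union> B) \<subseteq> B <#> {\<one>}"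
    using generate_subgroup_incl[OF order_refl Bsub] by auto
  then show ?case by (intro exI[of _ "{\<one>}"]) simp
next
  case (insert y Y)
  have Bc: "B \<subseteq> carrier G" using normal_imp_subgroup[OF B] by (rule subgroup.subset)
  obtain T where T: "finite T" "T \<subseteq> carrier G" "generate G (Y \<union> B) \<subseteq> B <#> T"
    using insert.IH insert.prems by auto
  obtain m where m: "0 < m" "y [^] (m::nat) \<in> B" using insert.prems(3)[of y] by blast
  let ?D = "generate G (Y \<union> B)" and ?E = "(\<lambda>e. y [^] e) ` {..<m}"
  have D: "?D \<lhd> G" using insert.prems by (intro normal_generate_mod_central[OF B]) auto
  have y: "y \<in> carrier G" and E: "?E \<subseteq> carrier G" using insert.prems by auto
  have BD: "Y \<union> B \<subseteq> ?D" by (auto intro: generate.incl)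
  have "generate G (insert y Y \<union> B) \<subseteq> generate G (insert y ?D)"
    using BD by (intro mono_generate) auto
  also have "\<dots> \<subseteq> ?D <#> ?E"
    using BD m by (intro generate_insert_normal_cover[OF D y]) auto
  also have "\<dots> \<subseteq> (B <#> T) <#> ?E" by (rule mono_set_mult[OF T(3) order_refl])
  also have "\<dots> = B <#> (T <#> ?E)" using Bc T E by (simp add: set_mult_assoc)
  finally show ?case
    using T E finite_set_mult[OF T(1), of ?E] setmult_subset_G[OF T(2) E] by blast
qed

end

locale powers_in_subgroup = group G for G (structure) +
  fixes K X :: "'a set" and k :: nat
  assumes K: "subgroup K G" and X_finite: "finite X" and X_carrier: "X \<subseteq> carrier G"
    and X_generates: "carrier G \<subseteq> generate G X"
    and k_pos: "0 < k" and powers: "x \<in> X \<Longrightarrow> x [^] k \<in> K"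
begin

text \<open>This is \<open>(K \<inter> C\<^sup>i) C\<^sup>i\<^sup>+\<^sup>1\<close>, the part of \<open>C\<^sup>i\<close> that \<open>K\<close> sees modulo \<open>C\<^sup>i\<^sup>+\<^sup>1\<close>. As a generated subgroup
  it can be treated by its generators.\<close>

definition layer :: "nat \<Rightarrow> 'a set" where
  "layer i = generate G ((K \<inter> lower_central G i) \<union> lower_central G (Suc i))"

lemma layer_gens_carrier: "(K \<inter> lower_central G i) \<union> lower_central G (Suc i) \<subseteq> carrier G"
  using lower_central_subset by blast

lemma lower_central_Suc_le_layer: "lower_central G (Suc i) \<subseteq> layer i"
  unfolding layer_def by (auto intro: generate.incl)

lemma layer_normal:
  assumes "1 \<le> i"
  shows "layer i \<lhd> G"
  unfolding layer_def
proof (rule normal_generate_mod_central[OF lower_central_normal])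
  show "K \<inter> lower_central G i \<subseteq> carrier G" using lower_central_subset by blast
  fix g y assume g: "g \<in> carrier G" and y: "y \<in> K \<inter> lower_central G i"
  then show "commutator G g y \<in> lower_central G (Suc i)"
    by (intro commutator_in_lower_central_Suc'[OF assms]) auto
qed

lemma layer_le_mult: "layer i \<subseteq> K <#> lower_central G (Suc i)"
proof -
  let ?N = "lower_central G (Suc i)"
  have "subgroup (K <#> ?N) G"
    using mult_norm_subgroup[OF lower_central_normal K]
    by (simp add: commut_normal[OF K lower_central_normal])
  moreover have "x \<in> K <#> ?N" if "x \<in> K \<inter> lower_central G i \<union> ?N" for x
  proof -
    have "x = x \<otimes> \<one>" "x = \<one> \<otimes> x" using that layer_gens_carrier[of i] by auto
    then show ?thesis
      using that subgroup.one_closed[OF K] subgroup.one_closed[OF lower_central_subgroup[of "Suc i"]]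
      unfolding set_mult_def by blast
  qed
  ultimately show ?thesis
    unfolding layer_def by (intro generate_subgroup_incl) auto
qed

lemma commutator_layer:
  assumes i: "1 \<le> i" and x: "x \<in> K" and c: "c \<in> layer i"
  shows "commutator G x c \<in> layer (Suc i)"
proof -
  have xc: "x \<in> carrier G" using x subgroup.subset[OF K] by blast
  show ?thesis
  proof (rule commutator_mod_generate[OF layer_normal xc layer_gens_carrier _ c[unfolded layer_def]])
    fix y assume y: "y \<in> (K \<inter> lower_central G i) \<union> lower_central G (Suc i)"
    have comm: "commutator G x y \<in> lower_central G (Suc j)" if "1 \<le> j" "y \<in> lower_central G j" for j
      by (rule commutator_in_lower_central_Suc'[OF that(1) xc that(2)])
    show "commutator G x y \<in> layer (Suc i)"
    proof (cases "y \<in> lower_central G (Suc i)")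
      case True
      then show ?thesis using comm[of "Suc i"] lower_central_Suc_le_layer[of "Suc i"] by auto
    next
      case False
      then have "commutator G x y \<in> K \<inter> lower_central G (Suc i)"
        using y comm[OF i] commutator_in_subgroup[OF K x] by blast
      then show ?thesis unfolding layer_def by (auto intro: generate.incl)
    qed
  qed simp
qed

text \<open>Modulo the next layer \<open>[y,x]\<close> is central, so that \<open>[y,x]\<^sup>m\<^sup>k = [y\<^sup>m, x\<^sup>k]\<close>, and this is trivial there since
  elements of \<open>K\<close> such as \<open>x\<^sup>k\<close> commute with those of \<open>layer i\<close> modulo \<open>layer (i + 1)\<close>.\<close>

lemma commutator_torsion:
  assumes i: "1 \<le> i" and y: "y \<in> lower_central G i" and ym: "y [^] (m::nat) \<in> layer i"
    and x: "x \<in> X"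
  shows "commutator G y x [^] (m * k) \<in> layer (Suc i)"
proof -
  let ?B = "layer (Suc i)"
  have B: "?B \<lhd> G" by (rule layer_normal) simp
  interpret Q: group_hom G "G Mod ?B" "\<lambda>x. ?B #> x" by (rule rcoset_hom[OF B])
  have xc: "x \<in> carrier G" and yc: "y \<in> carrier G"
    using x X_carrier y lower_central_subset by blast+
  let ?z = "commutator G y x"
  have zc: "?z \<in> carrier G" by (rule commutator_closed[OF yc xc])
  have one_iff: "?B #> g = \<one>\<^bsub>G Mod ?B\<^esub> \<longleftrightarrow> g \<in> ?B" if "g \<in> carrier G" for g
    by (rule rcoset_eq_one_iff[OF B that])
  have central: "(?B #> ?z) \<otimes>\<^bsub>G Mod ?B\<^esub> (?B #> g) = (?B #> g) \<otimes>\<^bsub>G Mod ?B\<^esub> (?B #> ?z)"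
    if g: "g \<in> carrier G" for g
  proof -
    have "commutator G ?z g \<in> lower_central G (Suc (Suc i))"
      using g by (rule commutator_in_lower_central_Suc[OF _ commutator_in_lower_central_Suc[OF i y xc], rotated]) simp
    then have "commutator G ?z g \<in> ?B" using lower_central_Suc_le_layer by blast
    then have "?B #> commutator G ?z g = \<one>\<^bsub>G Mod ?B\<^esub>"
      using one_iff[OF commutator_closed[OF zc g]] by blast
    then show ?thesis by (rule Q.hom_commutator_eq_one_iff[OF zc g, THEN iffD1])
  qed
  have xk: "x [^] k \<in> carrier G" and ymc: "y [^] m \<in> carrier G" using xc yc by simp_all
  have "commutator G (x [^] k) (y [^] m) \<in> ?B"
    by (rule commutator_layer[OF i powers[OF x] ym])
  then have "?B #> commutator G (x [^] k) (y [^] m) = \<one>\<^bsub>G Mod ?B\<^esub>"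
    using one_iff[OF commutator_closed[OF xk ymc]] by blast
  then have comm: "(?B #> x [^] k) \<otimes>\<^bsub>G Mod ?B\<^esub> (?B #> y [^] m) = (?B #> y [^] m) \<otimes>\<^bsub>G Mod ?B\<^esub> (?B #> x [^] k)"
    by (rule Q.hom_commutator_eq_one_iff[OF xk ymc, THEN iffD1])
  note Qz = Q.hom_commutator[OF yc xc]
  have "commutator (G Mod ?B) (?B #> y) (?B #> x) [^]\<^bsub>G Mod ?B\<^esub> (m * k) = \<one>\<^bsub>G Mod ?B\<^esub>"
    using central[OF xc] central[OF yc] comm[symmetric]
    unfolding Qz Q.hom_nat_pow[OF xc] Q.hom_nat_pow[OF yc]
    by (rule Q.H.commutator_pow_eq_one[OF Q.hom_closed[OF xc] Q.hom_closed[OF yc]])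
  then have "?B #> ?z [^] (m * k) = \<one>\<^bsub>G Mod ?B\<^esub>"
    unfolding Q.hom_nat_pow[OF zc] Qz .
  then show ?thesis by (rule one_iff[OF nat_pow_closed[OF zc], THEN iffD1])
qed

text \<open>For \<open>i = 1\<close> the set \<open>X\<close> serves as \<open>Y\<close>; afterwards the commutators \<open>[y,x]\<close> with \<open>y\<close> from the
  previous set do. That they generate \<open>C\<^sup>i\<^sup>+\<^sup>1\<close> modulo \<open>C\<^sup>i\<^sup>+\<^sup>2\<close> is seen without bilinearity: the subgroup \<open>B\<close>
  that they generate with \<open>C\<^sup>i\<^sup>+\<^sup>2\<close> is normal, and modulo \<open>B\<close> first each \<open>y\<close> commutes with all generators \<open>x\<close> and
  hence with \<open>G\<close>, and then all of \<open>C\<^sup>i\<close> does.\<close>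

lemma lower_central_torsion_generators:
  assumes "1 \<le> i"
  shows "\<exists>Y. finite Y \<and> Y \<subseteq> lower_central G i \<and>
    lower_central G i \<subseteq> generate G (Y \<union> lower_central G (Suc i)) \<and>
    (\<forall>y\<in>Y. \<exists>m>0. y [^] (m::nat) \<in> layer i)"
  using assms
proof (induction i rule: dec_induct)
  case base
  have "x [^] k \<in> layer 1" if "x \<in> X" for x
    unfolding layer_def using powers[OF that] that X_carrier by (auto intro: generate.incl)
  moreover have "generate G X \<subseteq> generate G (X \<union> lower_central G (Suc 1))"
    by (rule mono_generate) blast
  ultimately show ?case
    using X_finite X_carrier X_generates k_pos by (intro exI[of _ X]) auto
next
  case (step i)
  let ?N = "lower_central G (Suc (Suc i))"
  obtain Y where Y: "finite Y" "Y \<subseteq> lower_central G i"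
    "lower_central G i \<subseteq> generate G (Y \<union> lower_central G (Suc i))"
    "\<forall>y\<in>Y. \<exists>m>0. y [^] (m::nat) \<in> layer i"
    using step.IH by blast
  define Z where "Z = (\<lambda>(y, x). commutator G y x) ` (Y \<times> X)"
  have Z_Suc: "Z \<subseteq> lower_central G (Suc i)"
    using Y(2) X_carrier commutator_in_lower_central_Suc[OF step.hyps(1)] by (auto simp: Z_def)
  then have Zc: "Z \<subseteq> carrier G" using lower_central_subset by blast
  define B where "B = generate G (Z \<union> ?N)"
  have B: "B \<lhd> G"
    unfolding B_def
  proof (rule normal_generate_mod_central[OF lower_central_normal Zc])
    fix g z assume g: "g \<in> carrier G" and z: "z \<in> Z"
    then show "commutator G g z \<in> ?N"
      using Z_Suc by (intro commutator_in_lower_central_Suc') auto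
  qed
  have YC: "Y \<union> lower_central G (Suc i) \<subseteq> carrier G" using Y(2) lower_central_subset by blast
  have comm_B: "commutator G c g \<in> B" if c: "c \<in> lower_central G i" and g: "g \<in> carrier G" for c g
  proof (rule commutator_mod_generate_left[OF B g YC])
    show "c \<in> generate G (Y \<union> lower_central G (Suc i))" using c Y(3) by blast
    fix y assume y: "y \<in> Y \<union> lower_central G (Suc i)"
    show "commutator G y g \<in> B"
    proof (cases "y \<in> Y")
      case True
      show ?thesis
      proof (rule commutator_mod_generate[OF B _ X_carrier])
        show "y \<in> carrier G" using True YC by blast
        show "g \<in> generate G X" using g X_generates by blast
        fix x assume "x \<in> X"
        then have "commutator G y x \<in> Z" using True by (auto simp: Z_def)
        then show "commutator G y x \<in> B" by (simp add: B_def generate.incl)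
      qed
    next
      case False
      then have "commutator G y g \<in> ?N"
        using y g by (intro commutator_in_lower_central_Suc) auto
      then show ?thesis by (simp add: B_def generate.incl)
    qed
  qed
  have "lower_central G (Suc i) \<subseteq> B"
    unfolding lower_central_Suc[OF step.hyps(1)]
    using comm_B by (intro generate_subgroup_incl normal_imp_subgroup[OF B]) auto
  moreover have "\<exists>m>0. z [^] (m::nat) \<in> layer (Suc i)" if "z \<in> Z" for z
  proof -
    obtain y x where z: "z = commutator G y x" "y \<in> Y" "x \<in> X"
      using \<open>z \<in> Z\<close> by (auto simp: Z_def)
    obtain m where "m > 0" "y [^] (m::nat) \<in> layer i" using Y(4) z(2) by blast
    then show ?thesis
      using commutator_torsion[OF step.hyps(1)] z Y(2) k_pos by (intro exI[of _ "m * k"]) auto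
  qed
  moreover have "finite Z" using Y(1) X_finite by (simp add: Z_def)
  ultimately show ?case using Z_Suc unfolding B_def by blast
qed

text \<open>A covering by cosets of \<open>K C\<^sup>i\<close> refines to one by cosets of \<open>K C\<^sup>i\<^sup>+\<^sup>1\<close>: finitely many cosets of
  \<open>layer i\<close> cover \<open>C\<^sup>i\<close>, and \<open>layer i\<close> is contained in \<open>K C\<^sup>i\<^sup>+\<^sup>1\<close>.\<close>

lemma lower_central_cover:
  assumes "1 \<le> i"
  shows "\<exists>T. finite T \<and> T \<subseteq> carrier G \<and> carrier G \<subseteq> (K <#> lower_central G i) <#> T"
  using assms
proof (induction i rule: dec_induct)
  case base
  have "x \<in> (K <#> carrier G) <#> {\<one>}" if "x \<in> carrier G" for x
  proof -
    have "x = (\<one> \<otimes> x) \<otimes> \<one>" using that by simp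
    then show ?thesis using that subgroup.one_closed[OF K] unfolding set_mult_def by blast
  qed
  then show ?case by (intro exI[of _ "{\<one>}"]) auto
next
  case (step i)
  let ?C = "lower_central G i" and ?C' = "lower_central G (Suc i)"
  obtain T where T: "finite T" "T \<subseteq> carrier G" "carrier G \<subseteq> (K <#> ?C) <#> T"
    using step.IH by blast
  obtain Y where Y: "finite Y" "Y \<subseteq> ?C" "?C \<subseteq> generate G (Y \<union> ?C')"
    "\<forall>y\<in>Y. \<exists>m>0. y [^] (m::nat) \<in> layer i"
    using lower_central_torsion_generators[OF step.hyps(1)] by blast
  have Yc: "Y \<subseteq> carrier G" using Y(2) lower_central_subset by blast
  have "commutator G g y \<in> layer i" if "g \<in> carrier G" "y \<in> Y" for g y
  proof -
    have "commutator G g y \<in> ?C'"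
      using commutator_in_lower_central_Suc'[OF step.hyps(1)] that Y(2) by blast
    then show ?thesis using lower_central_Suc_le_layer by blast
  qed
  then obtain T' where T': "finite T'" "T' \<subseteq> carrier G" "generate G (Y \<union> layer i) \<subseteq> layer i <#> T'"
    using central_torsion_cover[OF layer_normal[OF step.hyps(1)] Y(1) Yc] Y(4) by blast
  have cars: "K \<subseteq> carrier G" "?C \<subseteq> carrier G" "?C' \<subseteq> carrier G"
    using subgroup.subset[OF K] lower_central_subset by blast+
  have "generate G (Y \<union> ?C') \<subseteq> generate G (Y \<union> layer i)"
    using lower_central_Suc_le_layer by (intro mono_generate) blast
  then have "?C \<subseteq> layer i <#> T'" using Y(3) T'(3) by blast
  also have "\<dots> \<subseteq> (K <#> ?C') <#> T'"
    by (rule mono_set_mult[OF layer_le_mult order_refl])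
  finally have C: "?C \<subseteq> (K <#> ?C') <#> T'" .
  have KK: "K <#> K = K" by (rule subgroup_mult_id[OF K])
  have "carrier G \<subseteq> (K <#> ((K <#> ?C') <#> T')) <#> T"
    using T(3) mono_set_mult[OF mono_set_mult[OF order_refl C] order_refl] by (rule order_trans)
  also have "\<dots> = ((K <#> K) <#> ?C') <#> (T' <#> T)"
    using cars T(2) T'(2) by (simp add: set_mult_assoc setmult_subset_G)
  finally have "carrier G \<subseteq> (K <#> ?C') <#> (T' <#> T)" unfolding KK .
  then show ?case
    using finite_set_mult[OF T'(1) T(1)] setmult_subset_G[OF T'(2) T(2)] by blast
qed

lemma finite_rcosets:
  assumes "lower_central G (n + 1) = {\<one>}"
  shows "finite (rcosets K)"
proof -
  obtain T where T: "finite T" "T \<subseteq> carrier G" "carrier G \<subseteq> (K <#> {\<one>}) <#> T"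
    using lower_central_cover[of "n + 1"] unfolding assms by auto
  have "K <#> {\<one>} = K" using coset_mult_one[OF subgroup.subset[OF K]] by (simp add: r_coset_eq_set_mult)
  then have cover: "carrier G \<subseteq> K <#> T" using T(3) by simp
  have "rcosets K \<subseteq> (\<lambda>t. K #> t) ` T"
  proof
    fix A assume "A \<in> rcosets K"
    then obtain x where x: "x \<in> carrier G" "A = K #> x" by (auto simp: RCOSETS_def)
    then obtain a t where "a \<in> K" "t \<in> T" "x = a \<otimes> t" using cover unfolding set_mult_def by blast
    then have "x \<in> K #> t" "t \<in> carrier G" using T(2) by (auto simp: r_coset_def)
    then have "A = K #> t" using x repr_independence[OF _ _ K] by simp
    then show "A \<in> (\<lambda>t. K #> t) ` T" using \<open>t \<in> T\<close> by blast
  qed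
  then show ?thesis using T(1) finite_surj by blast
qed

end

text \<open>Thus subgroups inherit nilpotency, and the finite index theorem applies inside the subgroup that
  is generated by a map.\<close>

lemma (in group) lower_central_subgroup_mono:
  assumes H: "subgroup H G"
  shows "lower_central (G\<lparr>carrier := H\<rparr>) i \<subseteq> lower_central G i"
proof (induction i)
  case 0
  then show ?case using subgroup.subset[OF H] by simp
next
  case (Suc i)
  interpret H: group "G\<lparr>carrier := H\<rparr>" by (rule subgroup_imp_group[OF H])
  show ?case
  proof (cases "i = 0")
    case True
    then show ?thesis using subgroup.subset[OF H] by simp
  next
    case False
    let ?H = "G\<lparr>carrier := H\<rparr>"
    let ?X = "{commutator ?H x y | x y. x \<in> lower_central ?H i \<and> y \<in> carrier ?H}"
    have X: "?X \<subseteq> H"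
      using H.lower_central_subset[of i] H.commutator_closed by (auto simp: subset_iff)
    have "?X \<subseteq> {commutator G x y | x y. x \<in> lower_central G i \<and> y \<in> carrier G}"
    proof
      fix c assume "c \<in> ?X"
      then obtain x y where c: "c = commutator ?H x y" "x \<in> lower_central ?H i" "y \<in> H" by auto
      have "x \<in> H" using c(2) H.lower_central_subset[of i] by auto
      then have "c = commutator G x y"
        using c m_inv_consistent[OF H] by (simp add: commutator_def)
      then show "c \<in> {commutator G x y | x y. x \<in> lower_central G i \<and> y \<in> carrier G}"
        using c Suc subgroup.subset[OF H] by blast
    qed
    then have "generate G ?X \<subseteq> lower_central G (Suc i)"
      using False by (simp add: lower_central_Suc mono_generate)
    moreover have "lower_central ?H (Suc i) = generate ?H ?X"
      using False by (simp add: lower_central_Suc)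
    ultimately show ?thesis using generate_consistent[OF X H] by simp
  qed
qed

lemma (in group) generate_finite_support:
  assumes "x \<in> generate G A"
  shows "\<exists>X. finite X \<and> X \<subseteq> A \<and> x \<in> generate G X"
  using assms
proof induction
  case one
  show ?case by (intro exI[of _ "{}"]) (simp add: generate.one)
next
  case (incl h)
  then show ?case by (intro exI[of _ "{h}"]) (simp add: generate.incl)
next
  case (inv h)
  then show ?case by (intro exI[of _ "{h}"]) (simp add: generate.inv)
next
  case (eng g h)
  then obtain X Y where XY: "finite X" "X \<subseteq> A" "g \<in> generate G X" "finite Y" "Y \<subseteq> A" "h \<in> generate G Y"
    by blast
  then have "g \<in> generate G (X \<union> Y)" "h \<in> generate G (X \<union> Y)"
    using mono_generate[of X "X \<union> Y"] mono_generate[of Y "X \<union> Y"] by auto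
  then show ?case using XY by (intro exI[of _ "X \<union> Y"]) (simp add: generate.eng)
qed

lemma (in group) finite_generating_subset:
  assumes "A \<subseteq> carrier G" "finitely_generated G (generate G A)"
  shows "\<exists>X. finite X \<and> X \<subseteq> A \<and> generate G X = generate G A"
proof -
  obtain B where B: "finite B" "B \<subseteq> generate G A" "generate G B = generate G A"
    using assms(2) by (auto simp: finitely_generated_def)
  have "\<forall>b\<in>B. \<exists>X. finite X \<and> X \<subseteq> A \<and> b \<in> generate G X"
    using generate_finite_support B(2) by blast
  then obtain X where X: "\<And>b. b \<in> B \<Longrightarrow> finite (X b) \<and> X b \<subseteq> A \<and> b \<in> generate G (X b)"
    by metis
  let ?X = "\<Union>(X ` B)"
  have sub: "?X \<subseteq> A" using X by blast
  have "B \<subseteq> generate G ?X"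
    using X mono_generate[of "X _" ?X] by blast
  then have "generate G A \<subseteq> generate G ?X"
    using generate_subgroup_incl[OF _ generate_is_subgroup] sub assms(1) B(3) by blast
  then have "generate G ?X = generate G A" using mono_generate[OF sub] by blast
  then show ?thesis using X B(1) sub by (intro exI[of _ ?X]) auto
qed

text \<open>The values of the ordered product at constant lists are the powers \<open>f(s)\<^sup>k\<close>, and finitely many
  of the values \<open>f(s)\<close> generate the subgroup.\<close>

lemma ordered_product_finite_index:
  assumes nil: "nilpotent_of_class G n" and f: "f \<in> carrier S \<rightarrow> carrier G"
    and fg: "finitely_generated G (generate G (f ` carrier S))" and k: "1 \<le> k"
  shows "finite_index_in G (generate G (ordered_product G f ` carrier (direct_sum k S)))
    (generate G (f ` carrier S))"
proof -
  have G: "group G" and triv: "lower_central G (n + 1) = {\<one>\<^bsub>G\<^esub>}"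
    using nil by (auto simp: nilpotent_of_class_def)
  interpret G: group G by fact
  let ?A = "f ` carrier S" and ?P = "ordered_product G f ` carrier (direct_sum k S)"
  define H where "H = generate G ?A"
  define K where "K = generate G ?P"
  have A: "?A \<subseteq> carrier G" using f by auto
  have H: "subgroup H G" unfolding H_def by (rule G.generate_is_subgroup[OF A])
  have fH: "f s \<in> H" if "s \<in> carrier S" for s using that by (simp add: H_def generate.incl)
  have "ordered_product G f xs \<in> H" if "set xs \<subseteq> carrier S" for xs
    using that
    by (induction xs) (auto simp: ordered_product_def fH subgroup.one_closed[OF H] subgroup.m_closed[OF H])
  then have P: "?P \<subseteq> H" by (auto simp: direct_sum_def)
  have K: "subgroup K G"
    unfolding K_def using P subgroup.subset[OF H] by (intro G.generate_is_subgroup) blast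
  have KH: "K \<subseteq> H" unfolding K_def by (rule G.generate_subgroup_incl[OF P H])
  let ?H = "G\<lparr>carrier := H\<rparr>"
  interpret H: group ?H by (rule G.subgroup_imp_group[OF H])
  have K_H: "subgroup K ?H" by (rule G.subgroup_incl[OF K H KH])
  obtain X where X: "finite X" "X \<subseteq> ?A" "generate G X = H"
    using G.finite_generating_subset[OF A fg] unfolding H_def by blast
  have XH: "X \<subseteq> H" using X(2) fH by blast
  have pow: "ordered_product G f (replicate j s) = f s [^]\<^bsub>G\<^esub> j" if "s \<in> carrier S" for s j
  proof (induction j)
    case 0
    then show ?case by (simp add: ordered_product_def)
  next
    case (Suc j)
    have "f s \<in> carrier G" using f that by blast
    then have "f s [^]\<^bsub>G\<^esub> Suc j = f s \<otimes>\<^bsub>G\<^esub> f s [^]\<^bsub>G\<^esub> j" by (rule G.nat_pow_Suc2)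
    then show ?case using Suc by (simp add: ordered_product_def)
  qed
  have "x [^]\<^bsub>?H\<^esub> k \<in> K" if "x \<in> X" for x
  proof -
    obtain s where s: "s \<in> carrier S" "x = f s" using \<open>x \<in> X\<close> X(2) by blast
    have "replicate k s \<in> carrier (direct_sum k S)" using s(1) by (auto simp: direct_sum_def)
    then have "ordered_product G f (replicate k s) \<in> K" unfolding K_def by (intro generate.incl imageI)
    then show ?thesis
      using pow[OF s(1), of k] s(2) by (simp flip: G.nat_pow_consistent)
  qed
  moreover have "generate ?H X = H" using X(3) G.generate_consistent[OF XH H] by simp
  ultimately interpret powers_in_subgroup ?H K X k
    using X(1) XH k
    by (intro powers_in_subgroup.intro powers_in_subgroup_axioms.intro H.is_group K_H) auto
  have "lower_central ?H (n + 1) \<subseteq> {\<one>\<^bsub>G\<^esub>}"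
    using G.lower_central_subgroup_mono[OF H, of "n + 1"] triv by simp
  then have "lower_central ?H (n + 1) = {\<one>\<^bsub>?H\<^esub>}"
    using subgroup.one_closed[OF H.lower_central_subgroup[of "n + 1"]] by auto
  then have "finite (rcosets\<^bsub>?H\<^esub> K)" by (rule finite_rcosets)
  then show ?thesis using K_H unfolding finite_index_in_def H_def K_def by blast
qed

theorem corollary8:
  fixes S :: "('a, 'm) semigrp_scheme" and G :: "('b, 'n) monoid_scheme"
    and n :: nat and f :: "'a \<Rightarrow> 'b" and d :: "nat \<Rightarrow> zstar"
  assumes "nonempty_comm_semigroup S"
    and "nilpotent_of_class G n"
    and "polynomial_map S G f"
    and "superadditive n d"
    and "bounded_above_by n (lc_degree S G f) d"
  shows "(\<forall>k\<ge>1. polynomial_map (direct_sum k S) G (ordered_product G f) \<and>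
                 bounded_above_by n (lc_degree (direct_sum k S) G (ordered_product G f)) d) \<and>
         (finitely_generated G (generate G (f ` carrier S)) \<longrightarrow>
          (\<forall>k\<ge>1. finite_index_in G
                   (generate G (ordered_product G f ` carrier (direct_sum k S)))
                   (generate G (f ` carrier S))))"
proof -
  have "f \<in> carrier S \<rightarrow> carrier G"
    using assms(3) by (auto simp: polynomial_map_def polynomial_map_le_def)
  then show ?thesis
    using ordered_product_lc_degree[OF assms] ordered_product_finite_index[OF assms(2)] by blast
qed

end
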